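(* Let $G$ be a group. The ring homomorphism $\mathscr{B}_{\mathcal{I}}(G)\colon\mathscr{B}(G)\to\mathscr{B}_{\mathsf{C}}(G)$ from the classical Burnside ring of $G$ to the categorified Burnside ring of $G$, induced by sending a finite right $G$-set $X$ to the discrete categorified $G$-set on $X$, is injective but not surjective.
   Context: A (right) categorified $G$-set is an internal category in the category of right $G$-sets: a small category $\mathcal{X}$ whose set of objects $\mathcal{X}_0$ and set of arrows $\mathcal{X}_1$ are right $G$-sets and whose source, target, identity and composition maps are $G$-equivariant (composable pairs carry the diagonal action). Morphisms are functors $\varphi$ with $\varphi_0,\varphi_1$ equivariant; 2-morphisms $\varphi\to\psi$ (for $\varphi,\psi\colon\mathcal{X}\to\mathcal{Y}$) are natural transformations given by a $G$-equivariant map $\mathcal{X}_0\to\mathcal{Y}_1$. $\mathcal{X}$ and $\mathcal{Y}$ are weakly equivalent if there are morphisms $\varphi\colon\mathcal{X}\to\mathcal{Y}$, $\psi\colon\mathcal{Y}\to\mathcal{X}$ and invertible 2-morphisms $\psi\varphi\to\mathrm{Id}_{\mathcal{X}}$, $\varphi\psi\to\mathrm{Id}_{\mathcal{Y}}$. $\mathcal{X}$ is finite if $\mathcal{X}_1$ is finite. Disjoint union $\uplus$ and product $\times$ (with diagonal action) are formed levelwise on objects and arrows. A rig is a unital commutative semiring. The classical Burnside rig $\mathscr{L}(G)$ is the rig of isomorphism classes of finite right $G$-sets, with addition induced by disjoint union and multiplication induced by cartesian product (diagonal action). The categorified Burnside rig $\mathscr{L}_{\mathsf{C}}(G)$ is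 the rig of weak equivalence classes of finite categorified $G$-sets, with addition induced by $\uplus$ and multiplication induced by $\times$. For a right $G$-set $X$, let $\mathcal{I}(X)$ be the categorified $G$-set with objects $X$, arrows $X$ and all of source, target, identity equal to $\mathrm{Id}_X$ (the discrete category on $X$). The rig homomorphism $\mathscr{L}_{\mathcal{I}}(G)\colon\mathscr{L}(G)\to\mathscr{L}_{\mathsf{C}}(G)$ is $[X]\mapsto[\mathcal{I}(X)]$. For a rig $L$, its Grothendieck ring $\mathscr{G}(L)$ consists of classes $[x,y]$, $x,y\in L$, with $[x,y]=[x',y']$ iff $x+y'+e=x'+y+e$ for some $e\in L$ (the universal ring completion). Put $\mathscr{B}(G)=\mathscr{G}(\mathscr{L}(G))$, $\mathscr{B}_{\mathsf{C}}(G)=\mathscr{G}(\mathscr{L}_{\mathsf{C}}(G))$ and $\mathscr{B}_{\mathcal{I}}(G)=\mathscr{G}(\mathscr{L}_{\mathcal{I}}(G))$. *)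

theory Defs
  imports "HOL-Algebra.RingHom"
begin

section \<open>Right G-sets\<close>

record ('x, 'g) gset =
  points :: "'x set"
  act :: "'x \<Rightarrow> 'g \<Rightarrow> 'x"

locale right_gset = group G for G (structure) +
  fixes X :: "('x, 'g) gset"
  assumes act_closed: "\<lbrakk>x \<in> points X; g \<in> carrier G\<rbrakk> \<Longrightarrow> act X x g \<in> points X"
    and act_one: "x \<in> points X \<Longrightarrow> act X x \<one> = x"
    and act_mult: "\<lbrakk>x \<in> points X; g \<in> carrier G; h \<in> carrier G\<rbrakk>
      \<Longrightarrow> act X x (g \<otimes> h) = act X (act X x g) h"

definition equivariant ::
  "('g, 'm) monoid_scheme \<Rightarrow> ('x, 'g) gset \<Rightarrow> ('y, 'g) gset \<Rightarrow> ('x \<Rightarrow> 'y) \<Rightarrow> bool" where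
  "equivariant G X Y f \<longleftrightarrow> f \<in> points X \<rightarrow> points Y \<and>
     (\<forall>x\<in>points X. \<forall>g\<in>carrier G. f (act X x g) = act Y (f x) g)"

definition gset_iso ::
  "('g, 'm) monoid_scheme \<Rightarrow> ('x, 'g) gset \<Rightarrow> ('y, 'g) gset \<Rightarrow> bool" where
  "gset_iso G X Y \<longleftrightarrow> (\<exists>f. equivariant G X Y f \<and> bij_betw f (points X) (points Y))"

definition gset_empty :: "(unit, 'g) gset" where
  "gset_empty = \<lparr>points = {}, act = \<lambda>x g. x\<rparr>"

definition gset_point :: "(unit, 'g) gset" where
  "gset_point = \<lparr>points = {()}, act = \<lambda>x g. x\<rparr>"

definition gset_sum :: "('x, 'g) gset \<Rightarrow> ('y, 'g) gset \<Rightarrow> ('x + 'y, 'g) gset" where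
  "gset_sum X Y = \<lparr>points = points X <+> points Y,
     act = \<lambda>z g. map_sum (\<lambda>x. act X x g) (\<lambda>y. act Y y g) z\<rparr>"

definition gset_prod :: "('x, 'g) gset \<Rightarrow> ('y, 'g) gset \<Rightarrow> ('x \<times> 'y, 'g) gset" where
  "gset_prod X Y = \<lparr>points = points X \<times> points Y,
     act = \<lambda>z g. map_prod (\<lambda>x. act X x g) (\<lambda>y. act Y y g) z\<rparr>"


section \<open>Categorified G-sets\<close>

text \<open>\<open>cmp X b a\<close> is the composite ``\<open>b\<close> after \<open>a\<close>''; it is only meaningful when
  \<open>src X b = tgt X a\<close>.\<close>

record ('o, 'a, 'g) catgset =
  Obj :: "('o, 'g) gset"
  Arr :: "('a, 'g) gset"
  src :: "'a \<Rightarrow> 'o"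
  tgt :: "'a \<Rightarrow> 'o"
  idn :: "'o \<Rightarrow> 'a"
  cmp :: "'a \<Rightarrow> 'a \<Rightarrow> 'a"

definition composable_pairs :: "('o, 'a, 'g) catgset \<Rightarrow> ('a \<times> 'a, 'g) gset" where
  "composable_pairs X =
     \<lparr>points = {(b, a). b \<in> points (Arr X) \<and> a \<in> points (Arr X) \<and> src X b = tgt X a},
      act = act (gset_prod (Arr X) (Arr X))\<rparr>"

locale categorified_gset =
  objects: right_gset G "Obj X" + arrows: right_gset G "Arr X"
  for G (structure) and X :: "('o, 'a, 'g) catgset" +
  assumes src_equivariant: "equivariant G (Arr X) (Obj X) (src X)"
    and tgt_equivariant: "equivariant G (Arr X) (Obj X) (tgt X)"
    and idn_equivariant: "equivariant G (Obj X) (Arr X) (idn X)"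
    and cmp_equivariant: "equivariant G (composable_pairs X) (Arr X) (\<lambda>(b, a). cmp X b a)"
    and src_idn: "x \<in> points (Obj X) \<Longrightarrow> src X (idn X x) = x"
    and tgt_idn: "x \<in> points (Obj X) \<Longrightarrow> tgt X (idn X x) = x"
    and src_cmp: "(b, a) \<in> points (composable_pairs X) \<Longrightarrow> src X (cmp X b a) = src X a"
    and tgt_cmp: "(b, a) \<in> points (composable_pairs X) \<Longrightarrow> tgt X (cmp X b a) = tgt X b"
    and cmp_idn_right: "a \<in> points (Arr X) \<Longrightarrow> cmp X a (idn X (src X a)) = a"
    and cmp_idn_left: "a \<in> points (Arr X) \<Longrightarrow> cmp X (idn X (tgt X a)) a = a"
    and cmp_assoc: "\<lbrakk>(c, b) \<in> points (composable_pairs X); (b, a) \<in> points (composable_pairs X)\<rbrakk>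
      \<Longrightarrow> cmp X (cmp X c b) a = cmp X c (cmp X b a)"

text \<open>A morphism is given by its object map \<open>p0\<close> and its arrow map \<open>p1\<close>.\<close>

definition catgset_morphism ::
  "('g, 'm) monoid_scheme \<Rightarrow> ('o, 'a, 'g) catgset \<Rightarrow> ('p, 'b, 'g) catgset
     \<Rightarrow> ('o \<Rightarrow> 'p) \<Rightarrow> ('a \<Rightarrow> 'b) \<Rightarrow> bool" where
  "catgset_morphism G X Y p0 p1 \<longleftrightarrow>
     equivariant G (Obj X) (Obj Y) p0 \<and> equivariant G (Arr X) (Arr Y) p1 \<and>
     (\<forall>a\<in>points (Arr X). src Y (p1 a) = p0 (src X a) \<and> tgt Y (p1 a) = p0 (tgt X a)) \<and>
     (\<forall>x\<in>points (Obj X). p1 (idn X x) = idn Y (p0 x)) \<and>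
     (\<forall>(b, a)\<in>points (composable_pairs X). p1 (cmp X b a) = cmp Y (p1 b) (p1 a))"

text \<open>2-morphisms \<open>(p0, p1) \<rightarrow> (q0, q1)\<close> between parallel morphisms from \<open>X\<close> to \<open>Y\<close>.\<close>

definition two_morphism ::
  "('g, 'm) monoid_scheme \<Rightarrow> ('o, 'a, 'g) catgset \<Rightarrow> ('p, 'b, 'g) catgset
     \<Rightarrow> ('o \<Rightarrow> 'p) \<Rightarrow> ('a \<Rightarrow> 'b) \<Rightarrow> ('o \<Rightarrow> 'p) \<Rightarrow> ('a \<Rightarrow> 'b) \<Rightarrow> ('o \<Rightarrow> 'b) \<Rightarrow> bool" where
  "two_morphism G X Y p0 p1 q0 q1 t \<longleftrightarrow>
     equivariant G (Obj X) (Arr Y) t \<and>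
     (\<forall>x\<in>points (Obj X). src Y (t x) = p0 x \<and> tgt Y (t x) = q0 x) \<and>
     (\<forall>a\<in>points (Arr X). cmp Y (t (tgt X a)) (p1 a) = cmp Y (q1 a) (t (src X a)))"

definition invertible_two_morphism ::
  "('g, 'm) monoid_scheme \<Rightarrow> ('o, 'a, 'g) catgset \<Rightarrow> ('p, 'b, 'g) catgset
     \<Rightarrow> ('o \<Rightarrow> 'p) \<Rightarrow> ('a \<Rightarrow> 'b) \<Rightarrow> ('o \<Rightarrow> 'p) \<Rightarrow> ('a \<Rightarrow> 'b) \<Rightarrow> ('o \<Rightarrow> 'b) \<Rightarrow> bool" where
  "invertible_two_morphism G X Y p0 p1 q0 q1 t \<longleftrightarrow>
     two_morphism G X Y p0 p1 q0 q1 t \<and>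
     (\<exists>s. two_morphism G X Y q0 q1 p0 p1 s \<and>
        (\<forall>x\<in>points (Obj X). cmp Y (s x) (t x) = idn Y (p0 x) \<and> cmp Y (t x) (s x) = idn Y (q0 x)))"

definition weakly_equivalent ::
  "('g, 'm) monoid_scheme \<Rightarrow> ('o, 'a, 'g) catgset \<Rightarrow> ('p, 'b, 'g) catgset \<Rightarrow> bool" where
  "weakly_equivalent G X Y \<longleftrightarrow> (\<exists>p0 p1 q0 q1 s t.
     catgset_morphism G X Y p0 p1 \<and> catgset_morphism G Y X q0 q1 \<and>
     invertible_two_morphism G X X (q0 \<circ> p0) (q1 \<circ> p1) id id s \<and>
     invertible_two_morphism G Y Y (p0 \<circ> q0) (p1 \<circ> q1) id id t)"

definition catgset_sum ::
  "('o, 'a, 'g) catgset \<Rightarrow> ('p, 'b, 'g) catgset \<Rightarrow> ('o + 'p, 'a + 'b, 'g) catgset" where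
  "catgset_sum X Y =
     \<lparr>Obj = gset_sum (Obj X) (Obj Y), Arr = gset_sum (Arr X) (Arr Y),
      src = map_sum (src X) (src Y), tgt = map_sum (tgt X) (tgt Y),
      idn = map_sum (idn X) (idn Y),
      cmp = \<lambda>d c. case (d, c) of
          (Inl b, Inl a) \<Rightarrow> Inl (cmp X b a)
        | (Inr b, Inr a) \<Rightarrow> Inr (cmp Y b a)
        | _ \<Rightarrow> undefined\<rparr>"

definition catgset_prod ::
  "('o, 'a, 'g) catgset \<Rightarrow> ('p, 'b, 'g) catgset \<Rightarrow> ('o \<times> 'p, 'a \<times> 'b, 'g) catgset" where
  "catgset_prod X Y =
     \<lparr>Obj = gset_prod (Obj X) (Obj Y), Arr = gset_prod (Arr X) (Arr Y),
      src = map_prod (src X) (src Y), tgt = map_prod (tgt X) (tgt Y),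
      idn = map_prod (idn X) (idn Y),
      cmp = \<lambda>d c. (cmp X (fst d) (fst c), cmp Y (snd d) (snd c))\<rparr>"

definition discrete :: "('x, 'g) gset \<Rightarrow> ('x, 'x, 'g) catgset" where
  "discrete X = \<lparr>Obj = X, Arr = X, src = id, tgt = id, idn = id, cmp = \<lambda>b a. b\<rparr>"


section \<open>The Burnside rigs\<close>

text \<open>Classes are formed among structures whose points (objects, arrows) are natural numbers.
  Every finite structure is isomorphic to one of these, see \<open>finite_gset_represented\<close> and
  \<open>finite_catgset_represented\<close> below, so this loses no classes.  The argument of
  \<open>gset_class\<close> and \<open>catgset_class\<close> itself may live on any type.\<close>

definition finite_gsets :: "('g, 'm) monoid_scheme \<Rightarrow> (nat, 'g) gset set" where
  "finite_gsets G = {X. right_gset G X \<and> finite (points X)}"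

definition gset_class :: "('g, 'm) monoid_scheme \<Rightarrow> ('x, 'g) gset \<Rightarrow> (nat, 'g) gset set" where
  "gset_class G X = {Z \<in> finite_gsets G. gset_iso G X Z}"

definition burnside_rig :: "('g, 'm) monoid_scheme \<Rightarrow> (nat, 'g) gset set ring" where
  "burnside_rig G =
     \<lparr>carrier = gset_class G ` finite_gsets G,
      mult = \<lambda>A B. \<Union>X\<in>A. \<Union>Y\<in>B. gset_class G (gset_prod X Y),
      one = gset_class G gset_point,
      zero = gset_class G gset_empty,
      add = \<lambda>A B. \<Union>X\<in>A. \<Union>Y\<in>B. gset_class G (gset_sum X Y)\<rparr>"

definition finite_catgsets :: "('g, 'm) monoid_scheme \<Rightarrow> (nat, nat, 'g) catgset set" where
  "finite_catgsets G = {X. categorified_gset G X \<and> finite (points (Arr X))}"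

definition catgset_class ::
  "('g, 'm) monoid_scheme \<Rightarrow> ('o, 'a, 'g) catgset \<Rightarrow> (nat, nat, 'g) catgset set" where
  "catgset_class G X = {Z \<in> finite_catgsets G. weakly_equivalent G X Z}"

definition cat_burnside_rig :: "('g, 'm) monoid_scheme \<Rightarrow> (nat, nat, 'g) catgset set ring" where
  "cat_burnside_rig G =
     \<lparr>carrier = catgset_class G ` finite_catgsets G,
      mult = \<lambda>A B. \<Union>X\<in>A. \<Union>Y\<in>B. catgset_class G (catgset_prod X Y),
      one = catgset_class G (discrete gset_point),
      zero = catgset_class G (discrete gset_empty),
      add = \<lambda>A B. \<Union>X\<in>A. \<Union>Y\<in>B. catgset_class G (catgset_sum X Y)\<rparr>"

definition discrete_rig_map ::
  "('g, 'm) monoid_scheme \<Rightarrow> (nat, 'g) gset set \<Rightarrow> (nat, nat, 'g) catgset set" where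
  "discrete_rig_map G A = (\<Union>X\<in>A. catgset_class G (discrete X))"


section \<open>The Grothendieck ring of a rig\<close>

definition groth_rel :: "('l, 'm) ring_scheme \<Rightarrow> (('l \<times> 'l) \<times> ('l \<times> 'l)) set" where
  "groth_rel L = {((x, y), (x', y')).
     x \<in> carrier L \<and> y \<in> carrier L \<and> x' \<in> carrier L \<and> y' \<in> carrier L \<and>
     (\<exists>e\<in>carrier L. x \<oplus>\<^bsub>L\<^esub> y' \<oplus>\<^bsub>L\<^esub> e = x' \<oplus>\<^bsub>L\<^esub> y \<oplus>\<^bsub>L\<^esub> e)}"

definition groth_class :: "('l, 'm) ring_scheme \<Rightarrow> 'l \<Rightarrow> 'l \<Rightarrow> ('l \<times> 'l) set" where
  "groth_class L x y = groth_rel L `` {(x, y)}"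

definition groth_ring :: "('l, 'm) ring_scheme \<Rightarrow> ('l \<times> 'l) set ring" where
  "groth_ring L =
     \<lparr>carrier = (carrier L \<times> carrier L) // groth_rel L,
      mult = \<lambda>A B. \<Union>(x, y)\<in>A. \<Union>(x', y')\<in>B.
        groth_class L (x \<otimes>\<^bsub>L\<^esub> x' \<oplus>\<^bsub>L\<^esub> y \<otimes>\<^bsub>L\<^esub> y') (x \<otimes>\<^bsub>L\<^esub> y' \<oplus>\<^bsub>L\<^esub> y \<otimes>\<^bsub>L\<^esub> x'),
      one = groth_class L \<one>\<^bsub>L\<^esub> \<zero>\<^bsub>L\<^esub>,
      zero = groth_class L \<zero>\<^bsub>L\<^esub> \<zero>\<^bsub>L\<^esub>,
      add = \<lambda>A B. \<Union>(x, y)\<in>A. \<Union>(x', y')\<in>B.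
        groth_class L (x \<oplus>\<^bsub>L\<^esub> x') (y \<oplus>\<^bsub>L\<^esub> y')\<rparr>"

definition groth_map ::
  "('k, 'm) ring_scheme \<Rightarrow> ('l \<Rightarrow> 'k) \<Rightarrow> ('l \<times> 'l) set \<Rightarrow> ('k \<times> 'k) set" where
  "groth_map K f A = (\<Union>(x, y)\<in>A. groth_class K (f x) (f y))"


section \<open>The Burnside rings\<close>

definition burnside_ring ::
  "('g, 'm) monoid_scheme \<Rightarrow> ((nat, 'g) gset set \<times> (nat, 'g) gset set) set ring" where
  "burnside_ring G = groth_ring (burnside_rig G)"

definition cat_burnside_ring ::
  "('g, 'm) monoid_scheme
     \<Rightarrow> ((nat, nat, 'g) catgset set \<times> (nat, nat, 'g) catgset set) set ring" where
  "cat_burnside_ring G = groth_ring (cat_burnside_rig G)"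

definition discrete_burnside_map ::
  "('g, 'm) monoid_scheme \<Rightarrow> ((nat, 'g) gset set \<times> (nat, 'g) gset set) set
     \<Rightarrow> ((nat, nat, 'g) catgset set \<times> (nat, nat, 'g) catgset set) set" where
  "discrete_burnside_map G = groth_map (cat_burnside_rig G) (discrete_rig_map G)"


section \<open>Every finite structure is represented on the natural numbers\<close>

lemma finite_gset_represented:
  fixes X :: "('x, 'g) gset"
  assumes "right_gset G X" and "finite (points X)"
  shows "\<exists>Z \<in> finite_gsets G. gset_iso G X Z"
proof -
  interpret right_gset G X by fact
  obtain f :: "'x \<Rightarrow> nat" where f: "inj_on f (points X)"
    using assms(2) finite_imp_inj_to_nat_seg by blast
  define k where "k = the_inv_into (points X) f"
  have k: "k (f x) = x" if "x \<in> points X" for x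
    using f that by (simp add: k_def the_inv_into_f_f)
  define Z where "Z = \<lparr>points = f ` points X, act = \<lambda>z g. f (act X (k z) g)\<rparr>"
  have "right_gset G Z"
    by unfold_locales (auto simp: Z_def k act_closed act_one act_mult)
  moreover have "equivariant G X Z f"
    by (auto simp: equivariant_def Z_def k)
  moreover have "bij_betw f (points X) (points Z)"
    using f by (simp add: Z_def bij_betw_def)
  ultimately show ?thesis
    using assms(2) unfolding finite_gsets_def gset_iso_def
    by (intro bexI[of _ Z]) (auto simp: Z_def)
qed

lemma finite_catgset_represented:
  fixes X :: "('o, 'a, 'g) catgset"
  assumes "categorified_gset G X" and "finite (points (Arr X))"
  shows "\<exists>Z \<in> finite_catgsets G. weakly_equivalent G X Z"
proof -
  interpret categorified_gset G X by fact
  have idn: "idn X x \<in> points (Arr X)" if "x \<in> points (Obj X)" for x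
    using that idn_equivariant by (auto simp: equivariant_def)
  have "inj_on (idn X) (points (Obj X))"
    by (metis inj_onI src_idn)
  then have "finite (points (Obj X))"
    using assms(2) idn by (meson finite_imageD finite_subset image_subsetI)
  then obtain f :: "'o \<Rightarrow> nat" where f: "inj_on f (points (Obj X))"
    using finite_imp_inj_to_nat_seg by blast
  obtain h :: "'a \<Rightarrow> nat" where h: "inj_on h (points (Arr X))"
    using assms(2) finite_imp_inj_to_nat_seg by blast
  define k where "k = the_inv_into (points (Obj X)) f"
  define l where "l = the_inv_into (points (Arr X)) h"
  have k: "k (f x) = x" if "x \<in> points (Obj X)" for x
    using f that by (simp add: k_def the_inv_into_f_f)
  have l: "l (h x) = x" if "x \<in> points (Arr X)" for x
    using h that by (simp add: l_def the_inv_into_f_f)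
  define Z where "Z =
    \<lparr>Obj = \<lparr>points = f ` points (Obj X), act = \<lambda>z g. f (act (Obj X) (k z) g)\<rparr>,
     Arr = \<lparr>points = h ` points (Arr X), act = \<lambda>z g. h (act (Arr X) (l z) g)\<rparr>,
     src = f \<circ> src X \<circ> l, tgt = f \<circ> tgt X \<circ> l, idn = h \<circ> idn X \<circ> k,
     cmp = \<lambda>b a. h (cmp X (l b) (l a))\<rparr>"
  note closed = objects.act_closed arrows.act_closed
  have st: "src X a \<in> points (Obj X)" "tgt X a \<in> points (Obj X)" if "a \<in> points (Arr X)" for a
    using that src_equivariant tgt_equivariant by (auto simp: equivariant_def)
  have feq: "f x = f y \<longleftrightarrow> x = y" if "x \<in> points (Obj X)" "y \<in> points (Obj X)" for x y
    using f that by (simp add: inj_on_eq_iff)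
  have eqs: "src X (act (Arr X) a g) = act (Obj X) (src X a) g"
     "tgt X (act (Arr X) a g) = act (Obj X) (tgt X a) g"
    if "a \<in> points (Arr X)" "g \<in> carrier G" for a g
    using that src_equivariant tgt_equivariant by (auto simp: equivariant_def)
  have eqi: "idn X (act (Obj X) x g) = act (Arr X) (idn X x) g"
    if "x \<in> points (Obj X)" "g \<in> carrier G" for x g
    using that idn_equivariant by (auto simp: equivariant_def)
  have cc: "cmp X b a \<in> points (Arr X)" "src X (cmp X b a) = src X a" "tgt X (cmp X b a) = tgt X b"
    if "b \<in> points (Arr X)" "a \<in> points (Arr X)" "src X b = tgt X a" for b a
  proof -
    have ba: "(b, a) \<in> points (composable_pairs X)"
      using that by (simp add: composable_pairs_def)
    show "src X (cmp X b a) = src X a" "tgt X (cmp X b a) = tgt X b"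
      by (rule src_cmp[OF ba], rule tgt_cmp[OF ba])
    have "(\<lambda>(b, a). cmp X b a) \<in> points (composable_pairs X) \<rightarrow> points (Arr X)"
      using cmp_equivariant by (simp add: equivariant_def)
    from Pi_mem[OF this ba] show "cmp X b a \<in> points (Arr X)" by simp
  qed
  have eqc: "cmp X (act (Arr X) b g) (act (Arr X) a g) = act (Arr X) (cmp X b a) g"
    if "b \<in> points (Arr X)" "a \<in> points (Arr X)" "src X b = tgt X a" "g \<in> carrier G" for b a g
    using that cmp_equivariant
    by (auto simp: equivariant_def composable_pairs_def gset_prod_def)
  have ass: "cmp X (cmp X c b) a = cmp X c (cmp X b a)"
    if "c \<in> points (Arr X)" "b \<in> points (Arr X)" "a \<in> points (Arr X)"
      "src X c = tgt X b" "src X b = tgt X a" for a b c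
    using that cmp_assoc by (auto simp: composable_pairs_def)
  have c: "cmp X (idn X x) (idn X x) = idn X x" if "x \<in> points (Obj X)" for x
    using cmp_idn_left[OF idn[OF that]] that by (simp add: tgt_idn)
  have "categorified_gset G Z"
    by unfold_locales
      (auto simp: Z_def k l closed objects.act_one arrows.act_one objects.act_mult arrows.act_mult
        equivariant_def composable_pairs_def gset_prod_def st eqs eqi eqc cc feq idn
        src_idn tgt_idn cmp_idn_left cmp_idn_right ass)
  moreover have "catgset_morphism G X Z f h" "catgset_morphism G Z X k l"
    by (auto simp: catgset_morphism_def Z_def k l closed st eqs eqi eqc cc feq idn
        equivariant_def composable_pairs_def gset_prod_def)
  moreover have "invertible_two_morphism G X X (k \<circ> f) (l \<circ> h) id id (idn X)"
    unfolding invertible_two_morphism_def two_morphism_def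
    by (intro conjI exI[of _ "idn X"])
      (auto simp: k l c idn idn_equivariant src_idn tgt_idn cmp_idn_left cmp_idn_right)
  moreover have "invertible_two_morphism G Z Z (f \<circ> k) (h \<circ> l) id id (idn Z)"
    unfolding invertible_two_morphism_def two_morphism_def
    by (intro conjI exI[of _ "idn Z"])
      (auto simp: Z_def equivariant_def k l c idn closed eqi src_idn tgt_idn cmp_idn_left
        cmp_idn_right st)
  ultimately have "weakly_equivalent G X Z" and Z: "categorified_gset G Z"
    unfolding weakly_equivalent_def by blast+
  moreover have "finite (points (Arr Z))"
    using assms(2) by (simp add: Z_def)
  ultimately show ?thesis
    by (auto simp: finite_catgsets_def)
qed

end

theory Submission
  imports Defs
begin

text \<open>
  The discrete embedding of rigs has an additive retraction: sending a categorified \<open>G\<close>-set to the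
  \<open>G\<close>-set of isomorphism classes of its objects is invariant under weak equivalence and additive, and
  it gives \<open>X\<close> back on the discrete category on \<open>X\<close>. Applying it to an equation witnessing equality
  in the Grothendieck ring gives injectivity. For non-surjectivity, the number of isomorphism classes
  of objects that are the source of a non-invertible arrow is a weakly invariant additive map to the
  natural numbers; it vanishes on discrete categories, hence on the image, but equals 1 on the one-object
  category given by the monoid \<open>{1, e}\<close> with \<open>e\<^sup>2 = e\<close> and trivial action.
\<close>

section \<open>Grothendieck rings\<close>

text \<open>Statements about the rigs do not pass to the Grothendieck rings by themselves: equality
  there allows an extra summand \<open>e\<close>, which on the categorified side need not be
  discrete, and an element of the image is a formal difference of two discrete classes. This is why
  both invariants are additive maps on the whole categorified rig: they can be applied to
  \<open>e\<close>, which the retraction turns into a legitimate summand on the classical side and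
  which cancels among natural numbers. Both are built from isomorphism classes, because equivalent
  categories may have different numbers of objects. The semiring laws are established for
  categories, by explicit isomorphisms, and the classical rig inherits them through its
  embedding.\<close>

locale rig = semiring L + comm_monoid L for L (structure)

text \<open>Commutativity turns the left distributive and annihilation laws into the right ones,
  which halves the work in instances.\<close>

lemma rigI:
  fixes L (structure)
  assumes "abelian_monoid L" "comm_monoid L"
    and l_distr: "\<And>x y z. \<lbrakk>x \<in> carrier L; y \<in> carrier L; z \<in> carrier L\<rbrakk>
      \<Longrightarrow> (x \<oplus> y) \<otimes> z = x \<otimes> z \<oplus> y \<otimes> z"
    and l_null: "\<And>x. x \<in> carrier L \<Longrightarrow> \<zero> \<otimes> x = \<zero>"
  shows "rig L"
proof -
  interpret abelian_monoid L by fact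
  interpret comm_monoid L by fact
  have "z \<otimes> (x \<oplus> y) = z \<otimes> x \<oplus> z \<otimes> y"
    if "x \<in> carrier L" "y \<in> carrier L" "z \<in> carrier L" for x y z
    using l_distr[OF that] that by (simp add: m_comm[of z])
  moreover have "x \<otimes> \<zero> = \<zero>" if "x \<in> carrier L" for x
    using l_null[OF that] that by (simp add: m_comm[of x])
  ultimately show ?thesis
    using l_distr l_null by unfold_locales
qed

lemma (in rig) groth_equiv: "equiv (carrier L \<times> carrier L) (groth_rel L)"
proof (rule equivI)
  show "groth_rel L \<subseteq> (carrier L \<times> carrier L) \<times> (carrier L \<times> carrier L)"
    by (auto simp: groth_rel_def)
  show "refl_on (carrier L \<times> carrier L) (groth_rel L)"
    by (auto simp: refl_on_def groth_rel_def)
  show "sym (groth_rel L)"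
    by (auto simp: sym_def groth_rel_def) metis
  show "trans (groth_rel L)"
  proof (rule transI, clarify)
    fix x y x' y' x'' y''
    assume "((x, y), (x', y')) \<in> groth_rel L" "((x', y'), (x'', y'')) \<in> groth_rel L"
    then obtain e e' where c: "x \<in> carrier L" "y \<in> carrier L" "x' \<in> carrier L" "y' \<in> carrier L"
        "x'' \<in> carrier L" "y'' \<in> carrier L" "e \<in> carrier L" "e' \<in> carrier L"
      and e: "x \<oplus> y' \<oplus> e = x' \<oplus> y \<oplus> e" and e': "x' \<oplus> y'' \<oplus> e' = x'' \<oplus> y' \<oplus> e'"
      by (auto simp: groth_rel_def)
    \<comment> \<open>There is no cancellation, so the middle entry \<open>y'\<close> cannot be
      removed; it is absorbed, with both old witnesses, into the new one.\<close>
    have "x \<oplus> y'' \<oplus> (y' \<oplus> e \<oplus> e') = (x \<oplus> y' \<oplus> e) \<oplus> (y'' \<oplus> e')"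
      using c by (simp add: a_ac)
    also have "\<dots> = (x' \<oplus> y'' \<oplus> e') \<oplus> (y \<oplus> e)"
      unfolding e using c by (simp add: a_ac)
    also have "\<dots> = x'' \<oplus> y \<oplus> (y' \<oplus> e \<oplus> e')"
      unfolding e' using c by (simp add: a_ac)
    finally show "((x, y), (x'', y'')) \<in> groth_rel L"
      using c by (auto simp: groth_rel_def intro!: bexI[of _ "y' \<oplus> e \<oplus> e'"])
  qed
qed

lemma (in rig) groth_class_self:
  "\<lbrakk>x \<in> carrier L; y \<in> carrier L\<rbrakk> \<Longrightarrow> (x, y) \<in> groth_class L x y"
  using equiv_class_self[OF groth_equiv] by (simp add: groth_class_def)

lemma (in rig) groth_class_eq_iff:
  assumes "x \<in> carrier L" "y \<in> carrier L" "x' \<in> carrier L" "y' \<in> carrier L"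
  shows "groth_class L x y = groth_class L x' y' \<longleftrightarrow>
    (\<exists>e\<in>carrier L. x \<oplus> y' \<oplus> e = x' \<oplus> y \<oplus> e)"
  using assms eq_equiv_class_iff[OF groth_equiv, of "(x, y)" "(x', y')"]
  by (simp add: groth_class_def groth_rel_def)

lemma (in rig) groth_class_eqI:
  assumes "x \<in> carrier L" "y \<in> carrier L" "x' \<in> carrier L" "y' \<in> carrier L"
    and "x \<oplus> y' = x' \<oplus> y"
  shows "groth_class L x y = groth_class L x' y'"
  using assms by (auto simp: groth_class_eq_iff)

lemma (in rig) groth_class_memD:
  assumes "(x', y') \<in> groth_class L x y"
  shows "x \<in> carrier L" "y \<in> carrier L" "x' \<in> carrier L" "y' \<in> carrier L"
    "groth_class L x' y' = groth_class L x y"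
  using assms equiv_class_eq[OF groth_equiv, of "(x, y)" "(x', y')"]
  by (auto simp: groth_class_def groth_rel_def)

lemma (in rig) groth_carrier:
  "carrier (groth_ring L) = {groth_class L x y |x y. x \<in> carrier L \<and> y \<in> carrier L}"
  by (auto simp: groth_ring_def groth_class_def quotient_def)

lemma (in rig) groth_class_closed [simp]:
  "\<lbrakk>x \<in> carrier L; y \<in> carrier L\<rbrakk> \<Longrightarrow> groth_class L x y \<in> carrier (groth_ring L)"
  by (auto simp: groth_carrier)

lemma (in rig) groth_carrierE:
  assumes "A \<in> carrier (groth_ring L)"
  obtains x y where "x \<in> carrier L" "y \<in> carrier L" "A = groth_class L x y"
  using assms by (auto simp: groth_carrier)

lemma (in rig) groth_zero: "\<zero>\<^bsub>groth_ring L\<^esub> = groth_class L \<zero> \<zero>"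
  and groth_one: "\<one>\<^bsub>groth_ring L\<^esub> = groth_class L \<one> \<zero>"
  by (simp_all add: groth_ring_def)

text \<open>Operations on classes are unions over representatives. Such a union collapses once its
  term is independent of the representative, because a class is nonempty.\<close>

lemma (in rig) groth_UN_class:
  assumes "x \<in> carrier L" "y \<in> carrier L"
    and "\<And>a b. (a, b) \<in> groth_class L x y \<Longrightarrow> F a b = C"
  shows "(\<Union>(a, b)\<in>groth_class L x y. F a b) = C"
  using groth_class_self[OF assms(1,2)] assms(3) by fastforce

lemma (in rig) groth_add:
  assumes "x \<in> carrier L" "y \<in> carrier L" "x' \<in> carrier L" "y' \<in> carrier L"
  shows "groth_class L x y \<oplus>\<^bsub>groth_ring L\<^esub> groth_class L x' y' = groth_class L (x \<oplus> x') (y \<oplus> y')"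
proof -
  have "groth_class L (a \<oplus> a') (b \<oplus> b') = groth_class L (x \<oplus> x') (y \<oplus> y')"
    if ab: "(a, b) \<in> groth_class L x y" and ab': "(a', b') \<in> groth_class L x' y'" for a b a' b'
  proof -
    note c = assms groth_class_memD(3,4)[OF ab] groth_class_memD(3,4)[OF ab']
    obtain e where e: "e \<in> carrier L" "a \<oplus> y \<oplus> e = x \<oplus> b \<oplus> e"
      using groth_class_memD(5)[OF ab] c by (auto simp: groth_class_eq_iff)
    obtain e' where e': "e' \<in> carrier L" "a' \<oplus> y' \<oplus> e' = x' \<oplus> b' \<oplus> e'"
      using groth_class_memD(5)[OF ab'] c by (auto simp: groth_class_eq_iff)
    have "(a \<oplus> a') \<oplus> (y \<oplus> y') \<oplus> (e \<oplus> e') = (a \<oplus> y \<oplus> e) \<oplus> (a' \<oplus> y' \<oplus> e')"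
      using c e(1) e'(1) by (simp add: a_ac)
    also have "\<dots> = (x \<oplus> x') \<oplus> (b \<oplus> b') \<oplus> (e \<oplus> e')"
      unfolding e(2) e'(2) using c e(1) e'(1) by (simp add: a_ac)
    finally show ?thesis
      using c e(1) e'(1) by (auto simp: groth_class_eq_iff intro!: bexI[of _ "e \<oplus> e'"])
  qed
  then show ?thesis
    using assms by (simp add: groth_ring_def groth_UN_class)
qed

text \<open>Changing one factor at a time keeps the witness linear in \<open>e\<close>;
  commutativity later gives the other factor.\<close>

lemma (in rig) groth_mult_cong_left:
  assumes "(a, b) \<in> groth_class L x y" "x' \<in> carrier L" "y' \<in> carrier L"
  shows "groth_class L (a \<otimes> x' \<oplus> b \<otimes> y') (a \<otimes> y' \<oplus> b \<otimes> x')
    = groth_class L (x \<otimes> x' \<oplus> y \<otimes> y') (x \<otimes> y' \<oplus> y \<otimes> x')"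
proof -
  note c = assms(2,3) groth_class_memD(1-4)[OF assms(1)]
  obtain e where e: "e \<in> carrier L" "a \<oplus> y \<oplus> e = x \<oplus> b \<oplus> e"
    using groth_class_memD(5)[OF assms(1)] c by (auto simp: groth_class_eq_iff)
  \<comment> \<open>The equation for \<open>e\<close> is used twice: multiplied by \<open>x'\<close>
    from left to right, and by \<open>y'\<close> from right to left. This produces the summand
    \<open>e \<otimes> x' \<oplus> e \<otimes> y'\<close>.\<close>
  have "(a \<otimes> x' \<oplus> b \<otimes> y') \<oplus> (x \<otimes> y' \<oplus> y \<otimes> x') \<oplus> (e \<otimes> x' \<oplus> e \<otimes> y')
      = (a \<oplus> y \<oplus> e) \<otimes> x' \<oplus> (x \<oplus> b \<oplus> e) \<otimes> y'"
    using c e(1) by (simp add: l_distr a_ac)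
  also have "\<dots> = (x \<oplus> b \<oplus> e) \<otimes> x' \<oplus> (a \<oplus> y \<oplus> e) \<otimes> y'"
    by (simp only: e(2))
  also have "\<dots> = (x \<otimes> x' \<oplus> y \<otimes> y') \<oplus> (a \<otimes> y' \<oplus> b \<otimes> x') \<oplus> (e \<otimes> x' \<oplus> e \<otimes> y')"
    using c e(1) by (simp add: l_distr a_ac)
  finally show ?thesis
    using c e(1) by (auto simp: groth_class_eq_iff intro!: bexI[of _ "e \<otimes> x' \<oplus> e \<otimes> y'"])
qed

lemma (in rig) groth_mult:
  assumes "x \<in> carrier L" "y \<in> carrier L" "x' \<in> carrier L" "y' \<in> carrier L"
  shows "groth_class L x y \<otimes>\<^bsub>groth_ring L\<^esub> groth_class L x' y'
    = groth_class L (x \<otimes> x' \<oplus> y \<otimes> y') (x \<otimes> y' \<oplus> y \<otimes> x')"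
proof -
  have "groth_class L (a \<otimes> a' \<oplus> b \<otimes> b') (a \<otimes> b' \<oplus> b \<otimes> a')
      = groth_class L (x \<otimes> x' \<oplus> y \<otimes> y') (x \<otimes> y' \<oplus> y \<otimes> x')"
    if ab: "(a, b) \<in> groth_class L x y" and ab': "(a', b') \<in> groth_class L x' y'" for a b a' b'
  proof -
    note c = assms groth_class_memD(3,4)[OF ab] groth_class_memD(3,4)[OF ab']
    have "groth_class L (a \<otimes> a' \<oplus> b \<otimes> b') (a \<otimes> b' \<oplus> b \<otimes> a')
        = groth_class L (x \<otimes> a' \<oplus> y \<otimes> b') (x \<otimes> b' \<oplus> y \<otimes> a')"
      using groth_mult_cong_left[OF ab] c by blast
    \<comment> \<open>The factors are exchanged so that the left congruence applies to the second
      one; the last step exchanges them back.\<close>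
    also have "\<dots> = groth_class L (a' \<otimes> x \<oplus> b' \<otimes> y) (a' \<otimes> y \<oplus> b' \<otimes> x)"
      using c by (simp add: m_comm a_comm)
    also have "\<dots> = groth_class L (x' \<otimes> x \<oplus> y' \<otimes> y) (x' \<otimes> y \<oplus> y' \<otimes> x)"
      using groth_mult_cong_left[OF ab'] c by blast
    also have "\<dots> = groth_class L (x \<otimes> x' \<oplus> y \<otimes> y') (x \<otimes> y' \<oplus> y \<otimes> x')"
      using c by (simp add: m_comm a_comm)
    finally show ?thesis .
  qed
  then show ?thesis
    using assms by (simp add: groth_ring_def groth_UN_class)
qed

lemmas (in rig) groth_ops = groth_add groth_mult groth_zero groth_one

theorem (in rig) groth_ring_cring: "cring (groth_ring L)"
proof (rule cringI)
  show "abelian_group (groth_ring L)"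
  proof (rule abelian_groupI)
    fix A assume "A \<in> carrier (groth_ring L)"
    then obtain x y where A: "x \<in> carrier L" "y \<in> carrier L" "A = groth_class L x y"
      by (rule groth_carrierE)
    \<comment> \<open>Exchanging the two entries of a formal difference gives its negative.\<close>
    have "groth_class L (y \<oplus> x) (x \<oplus> y) = groth_class L \<zero> \<zero>"
      by (rule groth_class_eqI) (use A in \<open>simp_all add: a_comm\<close>)
    then show "\<exists>B\<in>carrier (groth_ring L). B \<oplus>\<^bsub>groth_ring L\<^esub> A = \<zero>\<^bsub>groth_ring L\<^esub>"
      using A by (intro bexI[of _ "groth_class L y x"]) (simp_all add: groth_ops)
  qed (auto elim!: groth_carrierE simp: groth_ops a_ac)
  show "comm_monoid (groth_ring L)"
    by (rule comm_monoidI) (auto elim!: groth_carrierE simp: groth_ops l_distr r_distr a_ac m_ac)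
qed (auto elim!: groth_carrierE simp: groth_ops l_distr r_distr a_ac m_ac)

section \<open>Functoriality of the Grothendieck ring\<close>

locale rig_hom = source: rig L + target: rig K for L (structure) and K (structure) +
  fixes f
  assumes hom_closed [simp]: "x \<in> carrier L \<Longrightarrow> f x \<in> carrier K"
    and hom_add [simp]: "\<lbrakk>x \<in> carrier L; y \<in> carrier L\<rbrakk> \<Longrightarrow> f (x \<oplus>\<^bsub>L\<^esub> y) = f x \<oplus>\<^bsub>K\<^esub> f y"
    and hom_mult [simp]: "\<lbrakk>x \<in> carrier L; y \<in> carrier L\<rbrakk> \<Longrightarrow> f (x \<otimes>\<^bsub>L\<^esub> y) = f x \<otimes>\<^bsub>K\<^esub> f y"
    and hom_zero [simp]: "f \<zero>\<^bsub>L\<^esub> = \<zero>\<^bsub>K\<^esub>"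
    and hom_one [simp]: "f \<one>\<^bsub>L\<^esub> = \<one>\<^bsub>K\<^esub>"
begin

lemma groth_map_class:
  assumes "x \<in> carrier L" "y \<in> carrier L"
  shows "groth_map K f (groth_class L x y) = groth_class K (f x) (f y)"
  unfolding groth_map_def
proof (rule source.groth_UN_class[OF assms])
  fix a b assume ab: "(a, b) \<in> groth_class L x y"
  note c = source.groth_class_memD[OF ab]
  obtain e where e: "e \<in> carrier L" "a \<oplus>\<^bsub>L\<^esub> y \<oplus>\<^bsub>L\<^esub> e = x \<oplus>\<^bsub>L\<^esub> b \<oplus>\<^bsub>L\<^esub> e"
    using c by (auto simp: source.groth_class_eq_iff)
  have "f a \<oplus>\<^bsub>K\<^esub> f y \<oplus>\<^bsub>K\<^esub> f e = f x \<oplus>\<^bsub>K\<^esub> f b \<oplus>\<^bsub>K\<^esub> f e"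
    using arg_cong[OF e(2), of f] c e(1) by simp
  then show "groth_class K (f a) (f b) = groth_class K (f x) (f y)"
    using c e(1) by (auto simp: target.groth_class_eq_iff)
qed

theorem groth_map_ring_hom: "ring_hom_cring (groth_ring L) (groth_ring K) (groth_map K f)"
proof (intro ring_hom_cring.intro ring_hom_cring_axioms.intro
    source.groth_ring_cring target.groth_ring_cring)
  show "groth_map K f \<in> ring_hom (groth_ring L) (groth_ring K)"
    by (rule ring_hom_memI)
      (auto elim!: source.groth_carrierE simp: groth_map_class source.groth_add target.groth_add
        source.groth_mult target.groth_mult source.groth_one target.groth_one)
qed

text \<open>The Grothendieck relation is expressed by sums alone, so an additive \<open>r\<close>
  transports it: \<open>r e\<close> lies in \<open>L\<close> and witnesses the equality of the
  original classes.\<close>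

lemma groth_map_inj:
  assumes "\<And>x. x \<in> carrier K \<Longrightarrow> r x \<in> carrier L"
    and add: "\<And>x y. \<lbrakk>x \<in> carrier K; y \<in> carrier K\<rbrakk> \<Longrightarrow> r (x \<oplus>\<^bsub>K\<^esub> y) = r x \<oplus>\<^bsub>L\<^esub> r y"
    and retr: "\<And>x. x \<in> carrier L \<Longrightarrow> r (f x) = x"
  shows "inj_on (groth_map K f) (carrier (groth_ring L))"
proof (rule inj_onI)
  fix A B
  assume "A \<in> carrier (groth_ring L)" "B \<in> carrier (groth_ring L)"
    and eq: "groth_map K f A = groth_map K f B"
  then obtain x y x' y' where A: "A = groth_class L x y" "B = groth_class L x' y'"
    and c: "x \<in> carrier L" "y \<in> carrier L" "x' \<in> carrier L" "y' \<in> carrier L"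
    by (auto elim!: source.groth_carrierE)
  obtain e where e: "e \<in> carrier K" "f x \<oplus>\<^bsub>K\<^esub> f y' \<oplus>\<^bsub>K\<^esub> e = f x' \<oplus>\<^bsub>K\<^esub> f y \<oplus>\<^bsub>K\<^esub> e"
    using eq c by (auto simp: A groth_map_class target.groth_class_eq_iff)
  have "x \<oplus>\<^bsub>L\<^esub> y' \<oplus>\<^bsub>L\<^esub> r e = x' \<oplus>\<^bsub>L\<^esub> y \<oplus>\<^bsub>L\<^esub> r e" "r e \<in> carrier L"
    using arg_cong[OF e(2), of r] c e(1)
    by (simp_all add: add retr assms(1))
  then show "A = B"
    using c by (auto simp: A source.groth_class_eq_iff)
qed

text \<open>If the class of \<open>m\<close> were hit, \<open>m\<close> would equal the difference
  of some \<open>f x\<close> and \<open>f y\<close> up to a summand \<open>e\<close>. Since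
  \<open>u\<close> vanishes on \<open>f x\<close> and \<open>f y\<close>, the witnessing equation
  becomes \<open>u e = u m + u e\<close>.\<close>

lemma groth_map_not_surj:
  fixes u :: "_ \<Rightarrow> nat"
  assumes add: "\<And>x y. \<lbrakk>x \<in> carrier K; y \<in> carrier K\<rbrakk> \<Longrightarrow> u (x \<oplus>\<^bsub>K\<^esub> y) = u x + u y"
    and zero: "\<And>x. x \<in> carrier L \<Longrightarrow> u (f x) = 0"
    and m: "m \<in> carrier K" "u m \<noteq> 0"
  shows "groth_map K f ` carrier (groth_ring L) \<noteq> carrier (groth_ring K)"
proof
  assume "groth_map K f ` carrier (groth_ring L) = carrier (groth_ring K)"
  moreover have "groth_class K m \<zero>\<^bsub>K\<^esub> \<in> carrier (groth_ring K)"
    using m by simp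
  ultimately obtain A where A: "A \<in> carrier (groth_ring L)"
    "groth_map K f A = groth_class K m \<zero>\<^bsub>K\<^esub>"
    by (metis imageE)
  from A(1) obtain x y where c: "x \<in> carrier L" "y \<in> carrier L" "A = groth_class L x y"
    by (rule source.groth_carrierE)
  with A(2) have "groth_class K (f x) (f y) = groth_class K m \<zero>\<^bsub>K\<^esub>"
    by (simp add: groth_map_class)
  then obtain e where e: "e \<in> carrier K" "f x \<oplus>\<^bsub>K\<^esub> \<zero>\<^bsub>K\<^esub> \<oplus>\<^bsub>K\<^esub> e = m \<oplus>\<^bsub>K\<^esub> f y \<oplus>\<^bsub>K\<^esub> e"
    using m c by (auto simp: target.groth_class_eq_iff)
  show False
    using arg_cong[OF e(2), of u] c m e(1) by (simp add: add zero)
qed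

end

text \<open>An equation in \<open>L\<close> may be tested after applying the injective
  \<open>f\<close>, where it becomes a rig law of \<open>K\<close>. Hence no isomorphisms between
  \<open>G\<close>-sets are needed for the laws of the classical rig.\<close>

lemma rig_pullback:
  fixes L :: "('l, 'm) ring_scheme" and K :: "('k, 'n) ring_scheme"
  assumes "rig K" and inj: "inj_on f (carrier L)"
    and closed: "\<And>x. x \<in> carrier L \<Longrightarrow> f x \<in> carrier K"
      "\<And>x y. \<lbrakk>x \<in> carrier L; y \<in> carrier L\<rbrakk> \<Longrightarrow> x \<oplus>\<^bsub>L\<^esub> y \<in> carrier L"
      "\<And>x y. \<lbrakk>x \<in> carrier L; y \<in> carrier L\<rbrakk> \<Longrightarrow> x \<otimes>\<^bsub>L\<^esub> y \<in> carrier L"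
      "\<zero>\<^bsub>L\<^esub> \<in> carrier L" "\<one>\<^bsub>L\<^esub> \<in> carrier L"
    and hom: "\<And>x y. \<lbrakk>x \<in> carrier L; y \<in> carrier L\<rbrakk> \<Longrightarrow> f (x \<oplus>\<^bsub>L\<^esub> y) = f x \<oplus>\<^bsub>K\<^esub> f y"
      "\<And>x y. \<lbrakk>x \<in> carrier L; y \<in> carrier L\<rbrakk> \<Longrightarrow> f (x \<otimes>\<^bsub>L\<^esub> y) = f x \<otimes>\<^bsub>K\<^esub> f y"
      "f \<zero>\<^bsub>L\<^esub> = \<zero>\<^bsub>K\<^esub>" "f \<one>\<^bsub>L\<^esub> = \<one>\<^bsub>K\<^esub>"
  shows "rig_hom L K f"
proof -
  interpret K: rig K by fact
  note eq = inj_onD[OF inj]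
  have "rig L"
    by unfold_locales
      ((rule eq; simp add: closed hom K.a_ac K.m_ac K.l_distr K.r_distr) | simp add: closed)+
  then show ?thesis
    using assms by (simp add: rig_hom_def rig_hom_axioms_def)
qed

section \<open>Weak equivalence\<close>

context categorified_gset
begin

lemma src_closed [simp]: "a \<in> points (Arr X) \<Longrightarrow> src X a \<in> points (Obj X)"
  and tgt_closed [simp]: "a \<in> points (Arr X) \<Longrightarrow> tgt X a \<in> points (Obj X)"
  and idn_closed [simp]: "x \<in> points (Obj X) \<Longrightarrow> idn X x \<in> points (Arr X)"
  using src_equivariant tgt_equivariant idn_equivariant by (auto simp: equivariant_def)

lemma src_act [simp]:
  "\<lbrakk>a \<in> points (Arr X); g \<in> carrier G\<rbrakk> \<Longrightarrow> src X (act (Arr X) a g) = act (Obj X) (src X a) g"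
  using src_equivariant by (auto simp: equivariant_def)

lemma tgt_act [simp]:
  "\<lbrakk>a \<in> points (Arr X); g \<in> carrier G\<rbrakk> \<Longrightarrow> tgt X (act (Arr X) a g) = act (Obj X) (tgt X a) g"
  using tgt_equivariant by (auto simp: equivariant_def)

lemma idn_act [simp]:
  "\<lbrakk>x \<in> points (Obj X); g \<in> carrier G\<rbrakk> \<Longrightarrow> idn X (act (Obj X) x g) = act (Arr X) (idn X x) g"
  using idn_equivariant by (auto simp: equivariant_def)

declare objects.act_closed [simp] arrows.act_closed [simp] src_idn [simp] tgt_idn [simp]

lemma composable_iff:
  "(b, a) \<in> points (composable_pairs X) \<longleftrightarrow>
    b \<in> points (Arr X) \<and> a \<in> points (Arr X) \<and> src X b = tgt X a"
  by (simp add: composable_pairs_def)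

lemma cmp_simps [simp]:
  assumes "b \<in> points (Arr X)" "a \<in> points (Arr X)" "src X b = tgt X a"
  shows "cmp X b a \<in> points (Arr X)" "src X (cmp X b a) = src X a" "tgt X (cmp X b a) = tgt X b"
proof -
  have ba: "(b, a) \<in> points (composable_pairs X)"
    using assms by (simp add: composable_iff)
  show "src X (cmp X b a) = src X a" "tgt X (cmp X b a) = tgt X b"
    by (rule src_cmp[OF ba], rule tgt_cmp[OF ba])
  show "cmp X b a \<in> points (Arr X)"
    using cmp_equivariant ba by (force simp: equivariant_def)
qed

lemma cmp_act [simp]:
  assumes "b \<in> points (Arr X)" "a \<in> points (Arr X)" "src X b = tgt X a" "g \<in> carrier G"
  shows "cmp X (act (Arr X) b g) (act (Arr X) a g) = act (Arr X) (cmp X b a) g"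
  using cmp_equivariant assms
  by (auto simp: equivariant_def composable_pairs_def gset_prod_def)

lemma assoc:
  assumes "c \<in> points (Arr X)" "b \<in> points (Arr X)" "a \<in> points (Arr X)"
    "src X c = tgt X b" "src X b = tgt X a"
  shows "cmp X (cmp X c b) a = cmp X c (cmp X b a)"
  using assms cmp_assoc by (simp add: composable_iff)

text \<open>The object is a variable tied to the arrow by an equation, so that the rules still apply
  after \<open>src X a\<close> or \<open>tgt X a\<close> has been rewritten.\<close>

lemma cmp_idn [simp]:
  "\<lbrakk>a \<in> points (Arr X); src X a = x\<rbrakk> \<Longrightarrow> cmp X a (idn X x) = a"
  "\<lbrakk>a \<in> points (Arr X); tgt X a = x\<rbrakk> \<Longrightarrow> cmp X (idn X x) a = a"
  using cmp_idn_right cmp_idn_left by auto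

text \<open>Together with \<open>assoc\<close> this collapses the fourfold composites that arise
  when two inverse pairs are composed.\<close>

lemma cmp_cancel:
  assumes "c \<in> points (Arr X)" "b \<in> points (Arr X)" "a \<in> points (Arr X)"
    "src X c = tgt X b" "src X b = tgt X a" "cmp X c b = idn X x" "src X b = x"
  shows "cmp X c (cmp X b a) = a"
  using assms assoc[symmetric, of c b a] by simp

end

lemma right_gset_sum:
  "\<lbrakk>right_gset G X; right_gset G Y\<rbrakk> \<Longrightarrow> right_gset G (gset_sum X Y)"
  by (auto simp: right_gset_def right_gset_axioms_def gset_sum_def)

lemma right_gset_prod:
  "\<lbrakk>right_gset G X; right_gset G Y\<rbrakk> \<Longrightarrow> right_gset G (gset_prod X Y)"
  by (auto simp: right_gset_def right_gset_axioms_def gset_prod_def)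

lemma right_gset_empty: "group G \<Longrightarrow> right_gset G gset_empty"
  and right_gset_point: "group G \<Longrightarrow> right_gset G gset_point"
  by (auto simp: right_gset_def right_gset_axioms_def gset_empty_def gset_point_def)

lemma categorified_gset_sum:
  assumes "categorified_gset G X" "categorified_gset G Y"
  shows "categorified_gset G (catgset_sum X Y)"
proof -
  interpret X: categorified_gset G X by fact
  interpret Y: categorified_gset G Y by fact
  show ?thesis
    by (intro categorified_gset.intro categorified_gset_axioms.intro)
      (auto simp: catgset_sum_def X.objects.right_gset_axioms Y.objects.right_gset_axioms
        X.arrows.right_gset_axioms Y.arrows.right_gset_axioms right_gset_sum[unfolded gset_sum_def]
        equivariant_def composable_pairs_def gset_sum_def gset_prod_def X.assoc Y.assoc)
qed

lemma categorified_gset_prod: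
  assumes "categorified_gset G X" "categorified_gset G Y"
  shows "categorified_gset G (catgset_prod X Y)"
proof -
  interpret X: categorified_gset G X by fact
  interpret Y: categorified_gset G Y by fact
  show ?thesis
    by (intro categorified_gset.intro categorified_gset_axioms.intro)
      (auto simp: catgset_prod_def X.objects.right_gset_axioms Y.objects.right_gset_axioms
        X.arrows.right_gset_axioms Y.arrows.right_gset_axioms right_gset_prod[unfolded gset_prod_def]
        equivariant_def composable_pairs_def gset_prod_def X.assoc Y.assoc)
qed

lemma categorified_gset_discrete:
  assumes "right_gset G X"
  shows "categorified_gset G (discrete X)"
proof -
  interpret right_gset G X by fact
  show ?thesis
    by unfold_locales
      (auto simp: discrete_def act_closed act_one act_mult equivariant_def
        composable_pairs_def gset_prod_def)
qed

section \<open>Functors, transformations and natural isomorphisms\<close>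

definition nat_iso ::
  "('g, 'm) monoid_scheme \<Rightarrow> ('o, 'a, 'g) catgset \<Rightarrow> ('p, 'b, 'g) catgset
     \<Rightarrow> ('o \<Rightarrow> 'p) \<Rightarrow> ('a \<Rightarrow> 'b) \<Rightarrow> ('o \<Rightarrow> 'p) \<Rightarrow> ('a \<Rightarrow> 'b) \<Rightarrow> bool" where
  "nat_iso G X Y p0 p1 q0 q1 \<longleftrightarrow> (\<exists>t. invertible_two_morphism G X Y p0 p1 q0 q1 t)"

lemma nat_isoI:
  assumes "two_morphism G X Y p0 p1 q0 q1 t" "two_morphism G X Y q0 q1 p0 p1 s"
    and "\<And>x. x \<in> points (Obj X) \<Longrightarrow> cmp Y (s x) (t x) = idn Y (p0 x)"
    and "\<And>x. x \<in> points (Obj X) \<Longrightarrow> cmp Y (t x) (s x) = idn Y (q0 x)"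
  shows "nat_iso G X Y p0 p1 q0 q1"
  using assms unfolding nat_iso_def invertible_two_morphism_def by blast

lemma nat_isoE:
  assumes "nat_iso G X Y p0 p1 q0 q1"
  obtains t s where "two_morphism G X Y p0 p1 q0 q1 t" "two_morphism G X Y q0 q1 p0 p1 s"
    and "\<forall>x\<in>points (Obj X). cmp Y (s x) (t x) = idn Y (p0 x)"
    and "\<forall>x\<in>points (Obj X). cmp Y (t x) (s x) = idn Y (q0 x)"
  using assms unfolding nat_iso_def invertible_two_morphism_def by blast

text \<open>Hiding the transformations makes natural isomorphism a relation between functors, which
  can be composed and whiskered without naming components.\<close>

lemma weakly_equivalent_iff:
  "weakly_equivalent G X Y \<longleftrightarrow> (\<exists>p0 p1 q0 q1.
     catgset_morphism G X Y p0 p1 \<and> catgset_morphism G Y X q0 q1 \<and>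
     nat_iso G X X (q0 \<circ> p0) (q1 \<circ> p1) id id \<and> nat_iso G Y Y (p0 \<circ> q0) (p1 \<circ> q1) id id)"
  unfolding weakly_equivalent_def nat_iso_def by blast

lemma catgset_morphismD:
  assumes "catgset_morphism G X Y p0 p1"
  shows "x \<in> points (Obj X) \<Longrightarrow> p0 x \<in> points (Obj Y)"
    "a \<in> points (Arr X) \<Longrightarrow> p1 a \<in> points (Arr Y)"
    "\<lbrakk>x \<in> points (Obj X); g \<in> carrier G\<rbrakk> \<Longrightarrow> p0 (act (Obj X) x g) = act (Obj Y) (p0 x) g"
    "\<lbrakk>a \<in> points (Arr X); g \<in> carrier G\<rbrakk> \<Longrightarrow> p1 (act (Arr X) a g) = act (Arr Y) (p1 a) g"
    "a \<in> points (Arr X) \<Longrightarrow> src Y (p1 a) = p0 (src X a)"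
    "a \<in> points (Arr X) \<Longrightarrow> tgt Y (p1 a) = p0 (tgt X a)"
    "x \<in> points (Obj X) \<Longrightarrow> p1 (idn X x) = idn Y (p0 x)"
    "\<lbrakk>b \<in> points (Arr X); a \<in> points (Arr X); src X b = tgt X a\<rbrakk>
      \<Longrightarrow> p1 (cmp X b a) = cmp Y (p1 b) (p1 a)"
  using assms by (auto simp: catgset_morphism_def equivariant_def composable_pairs_def)

lemma catgset_morphismI:
  assumes "\<And>x. x \<in> points (Obj X) \<Longrightarrow> p0 x \<in> points (Obj Y)"
    "\<And>a. a \<in> points (Arr X) \<Longrightarrow> p1 a \<in> points (Arr Y)"
    "\<And>x g. \<lbrakk>x \<in> points (Obj X); g \<in> carrier G\<rbrakk> \<Longrightarrow> p0 (act (Obj X) x g) = act (Obj Y) (p0 x) g"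
    "\<And>a g. \<lbrakk>a \<in> points (Arr X); g \<in> carrier G\<rbrakk> \<Longrightarrow> p1 (act (Arr X) a g) = act (Arr Y) (p1 a) g"
    "\<And>a. a \<in> points (Arr X) \<Longrightarrow> src Y (p1 a) = p0 (src X a)"
    "\<And>a. a \<in> points (Arr X) \<Longrightarrow> tgt Y (p1 a) = p0 (tgt X a)"
    "\<And>x. x \<in> points (Obj X) \<Longrightarrow> p1 (idn X x) = idn Y (p0 x)"
    "\<And>b a. \<lbrakk>b \<in> points (Arr X); a \<in> points (Arr X); src X b = tgt X a\<rbrakk>
      \<Longrightarrow> p1 (cmp X b a) = cmp Y (p1 b) (p1 a)"
  shows "catgset_morphism G X Y p0 p1"
  using assms by (auto simp: catgset_morphism_def equivariant_def composable_pairs_def)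

lemma catgset_morphism_comp:
  assumes "categorified_gset G X"
    and "catgset_morphism G X Y p0 p1" "catgset_morphism G Y Z q0 q1"
  shows "catgset_morphism G X Z (q0 \<circ> p0) (q1 \<circ> p1)"
proof -
  interpret categorified_gset G X by fact
  show ?thesis
    by (rule catgset_morphismI)
      (simp_all add: catgset_morphismD[OF assms(2)] catgset_morphismD[OF assms(3)])
qed

lemma catgset_morphism_id: "catgset_morphism G X X id id"
  by (rule catgset_morphismI) auto

lemma two_morphismD:
  assumes "two_morphism G X Y p0 p1 q0 q1 t"
  shows "x \<in> points (Obj X) \<Longrightarrow> t x \<in> points (Arr Y)"
    "\<lbrakk>x \<in> points (Obj X); g \<in> carrier G\<rbrakk> \<Longrightarrow> t (act (Obj X) x g) = act (Arr Y) (t x) g"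
    "x \<in> points (Obj X) \<Longrightarrow> src Y (t x) = p0 x"
    "x \<in> points (Obj X) \<Longrightarrow> tgt Y (t x) = q0 x"
    "a \<in> points (Arr X) \<Longrightarrow> cmp Y (t (tgt X a)) (p1 a) = cmp Y (q1 a) (t (src X a))"
  using assms by (auto simp: two_morphism_def equivariant_def)

lemma two_morphismI:
  assumes "\<And>x. x \<in> points (Obj X) \<Longrightarrow> t x \<in> points (Arr Y)"
    "\<And>x g. \<lbrakk>x \<in> points (Obj X); g \<in> carrier G\<rbrakk> \<Longrightarrow> t (act (Obj X) x g) = act (Arr Y) (t x) g"
    "\<And>x. x \<in> points (Obj X) \<Longrightarrow> src Y (t x) = p0 x"
    "\<And>x. x \<in> points (Obj X) \<Longrightarrow> tgt Y (t x) = q0 x"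
    "\<And>a. a \<in> points (Arr X) \<Longrightarrow> cmp Y (t (tgt X a)) (p1 a) = cmp Y (q1 a) (t (src X a))"
  shows "two_morphism G X Y p0 p1 q0 q1 t"
  using assms by (auto simp: two_morphism_def equivariant_def)

text \<open>Vertical composition: the naturality square of the composite is the pasting of the
  squares of \<open>t\<close> and \<open>u\<close>, with associativity moving the brackets in
  between.\<close>

lemma two_morphism_vcomp:
  assumes "categorified_gset G X" "categorified_gset G Y"
    and p: "catgset_morphism G X Y p0 p1" and q: "catgset_morphism G X Y q0 q1"
    and r: "catgset_morphism G X Y r0 r1"
    and t: "two_morphism G X Y p0 p1 q0 q1 t" and u: "two_morphism G X Y q0 q1 r0 r1 u"
  shows "two_morphism G X Y p0 p1 r0 r1 (\<lambda>x. cmp Y (u x) (t x))"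
proof -
  interpret X: categorified_gset G X by fact
  interpret Y: categorified_gset G Y by fact
  note D = two_morphismD(1-4)[OF t] two_morphismD(1-4)[OF u]
    catgset_morphismD[OF p] catgset_morphismD[OF q] catgset_morphismD[OF r]
  have "cmp Y (cmp Y (u (tgt X a)) (t (tgt X a))) (p1 a)
      = cmp Y (r1 a) (cmp Y (u (src X a)) (t (src X a)))" if a: "a \<in> points (Arr X)" for a
  proof -
    have "cmp Y (cmp Y (u (tgt X a)) (t (tgt X a))) (p1 a)
        = cmp Y (u (tgt X a)) (cmp Y (t (tgt X a)) (p1 a))"
      using a by (simp add: D Y.assoc)
    also have "\<dots> = cmp Y (cmp Y (u (tgt X a)) (q1 a)) (t (src X a))"
      using a by (simp add: two_morphismD(5)[OF t] D Y.assoc)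
    also have "\<dots> = cmp Y (r1 a) (cmp Y (u (src X a)) (t (src X a)))"
      using a by (simp add: two_morphismD(5)[OF u] D Y.assoc)
    finally show ?thesis .
  qed
  then show ?thesis
    by (intro two_morphismI) (simp_all add: D)
qed

text \<open>A functor sends naturality squares to commuting squares. Its composition rule is used
  from right to left, so that both sides become images of composites in \<open>Y\<close>.\<close>

lemma two_morphism_whisker_left:
  assumes "categorified_gset G X" "catgset_morphism G X Y p0 p1" "catgset_morphism G X Y q0 q1"
    and r: "catgset_morphism G Y Z r0 r1" and t: "two_morphism G X Y p0 p1 q0 q1 t"
  shows "two_morphism G X Z (r0 \<circ> p0) (r1 \<circ> p1) (r0 \<circ> q0) (r1 \<circ> q1) (r1 \<circ> t)"
proof -
  interpret X: categorified_gset G X by fact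
  note D = two_morphismD(1-4)[OF t] catgset_morphismD[OF assms(2)] catgset_morphismD[OF assms(3)]
    catgset_morphismD(1-7)[OF r]
  show ?thesis
    by (rule two_morphismI)
      (simp_all add: D catgset_morphismD(8)[OF r, symmetric] two_morphismD(5)[OF t])
qed

text \<open>Naturality at \<open>a\<close> is naturality of \<open>t\<close> at the arrow
  \<open>r1 a\<close>.\<close>

lemma two_morphism_whisker_right:
  assumes "categorified_gset G W" "catgset_morphism G W X r0 r1"
    and t: "two_morphism G X Y p0 p1 q0 q1 t"
  shows "two_morphism G W Y (p0 \<circ> r0) (p1 \<circ> r1) (q0 \<circ> r0) (q1 \<circ> r1) (t \<circ> r0)"
proof -
  interpret W: categorified_gset G W by fact
  note D = two_morphismD(1-4)[OF t] catgset_morphismD[OF assms(2)]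
  have "cmp Y (t (r0 (tgt W a))) (p1 (r1 a)) = cmp Y (q1 (r1 a)) (t (r0 (src W a)))"
    if "a \<in> points (Arr W)" for a
    using two_morphismD(5)[OF t, of "r1 a"] that by (simp add: D)
  then show ?thesis
    by (intro two_morphismI) (simp_all add: D)
qed

lemma nat_iso_trans:
  assumes X: "categorified_gset G X" and Y: "categorified_gset G Y"
    and m: "catgset_morphism G X Y p0 p1" "catgset_morphism G X Y q0 q1"
      "catgset_morphism G X Y r0 r1"
    and "nat_iso G X Y p0 p1 q0 q1" "nat_iso G X Y q0 q1 r0 r1"
  shows "nat_iso G X Y p0 p1 r0 r1"
proof -
  interpret X: categorified_gset G X by fact
  interpret Y: categorified_gset G Y by fact
  obtain t t' where t: "two_morphism G X Y p0 p1 q0 q1 t" "two_morphism G X Y q0 q1 p0 p1 t'"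
    and tt: "\<forall>x\<in>points (Obj X). cmp Y (t' x) (t x) = idn Y (p0 x)"
      "\<forall>x\<in>points (Obj X). cmp Y (t x) (t' x) = idn Y (q0 x)"
    using assms(6) by (rule nat_isoE)
  obtain u u' where u: "two_morphism G X Y q0 q1 r0 r1 u" "two_morphism G X Y r0 r1 q0 q1 u'"
    and uu: "\<forall>x\<in>points (Obj X). cmp Y (u' x) (u x) = idn Y (q0 x)"
      "\<forall>x\<in>points (Obj X). cmp Y (u x) (u' x) = idn Y (r0 x)"
    using assms(7) by (rule nat_isoE)
  note D = two_morphismD(1,3,4)[OF t(1)] two_morphismD(1,3,4)[OF t(2)]
    two_morphismD(1,3,4)[OF u(1)] two_morphismD(1,3,4)[OF u(2)]
  show ?thesis
  proof (rule nat_isoI)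
    show "two_morphism G X Y p0 p1 r0 r1 (\<lambda>x. cmp Y (u x) (t x))"
      by (rule two_morphism_vcomp[OF X Y m(1,2,3) t(1) u(1)])
    show "two_morphism G X Y r0 r1 p0 p1 (\<lambda>x. cmp Y (t' x) (u' x))"
      by (rule two_morphism_vcomp[OF X Y m(3,2,1) u(2) t(2)])
  qed (simp_all add: D Y.assoc tt uu Y.cmp_cancel)
qed

lemma nat_iso_whisker_left:
  assumes "categorified_gset G X" "catgset_morphism G X Y p0 p1" "catgset_morphism G X Y q0 q1"
    and r: "catgset_morphism G Y Z r0 r1" and "nat_iso G X Y p0 p1 q0 q1"
  shows "nat_iso G X Z (r0 \<circ> p0) (r1 \<circ> p1) (r0 \<circ> q0) (r1 \<circ> q1)"
proof -
  obtain t s where ts: "two_morphism G X Y p0 p1 q0 q1 t" "two_morphism G X Y q0 q1 p0 p1 s"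
    and inv: "\<forall>x\<in>points (Obj X). cmp Y (s x) (t x) = idn Y (p0 x)"
      "\<forall>x\<in>points (Obj X). cmp Y (t x) (s x) = idn Y (q0 x)"
    using assms(5) by (rule nat_isoE)
  show ?thesis
    using two_morphism_whisker_left[OF assms(1,2,3) r ts(1)]
      two_morphism_whisker_left[OF assms(1,3,2) r ts(2)]
    by (rule nat_isoI)
      (simp_all add: catgset_morphismD(8)[OF r, symmetric] inv catgset_morphismD(7)[OF r]
        two_morphismD(1,3,4)[OF ts(1)] two_morphismD(1,3,4)[OF ts(2)]
        catgset_morphismD(1)[OF assms(2)] catgset_morphismD(1)[OF assms(3)])
qed

lemma nat_iso_whisker_right:
  assumes "categorified_gset G W" and r: "catgset_morphism G W X r0 r1"
    and "nat_iso G X Y p0 p1 q0 q1"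
  shows "nat_iso G W Y (p0 \<circ> r0) (p1 \<circ> r1) (q0 \<circ> r0) (q1 \<circ> r1)"
proof -
  obtain t s where ts: "two_morphism G X Y p0 p1 q0 q1 t" "two_morphism G X Y q0 q1 p0 p1 s"
    and inv: "\<forall>x\<in>points (Obj X). cmp Y (s x) (t x) = idn Y (p0 x)"
      "\<forall>x\<in>points (Obj X). cmp Y (t x) (s x) = idn Y (q0 x)"
    using assms(3) by (rule nat_isoE)
  show ?thesis
    using two_morphism_whisker_right[OF assms(1) r ts(1)]
      two_morphism_whisker_right[OF assms(1) r ts(2)]
    by (rule nat_isoI) (simp_all add: inv catgset_morphismD(1)[OF r])
qed

text \<open>The components are identities. Agreement is required on the carriers only, which suits
  inverses obtained from \<open>the_inv_into\<close>, whose values elsewhere are arbitrary.\<close>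

lemma nat_iso_eq:
  assumes "categorified_gset G X" "categorified_gset G Y" and q: "catgset_morphism G X Y q0 q1"
    and "\<And>x. x \<in> points (Obj X) \<Longrightarrow> p0 x = q0 x" "\<And>a. a \<in> points (Arr X) \<Longrightarrow> p1 a = q1 a"
  shows "nat_iso G X Y p0 p1 q0 q1"
proof -
  interpret X: categorified_gset G X by fact
  interpret Y: categorified_gset G Y by fact
  show ?thesis
    by (rule nat_isoI[where t = "idn Y \<circ> q0" and s = "idn Y \<circ> q0"]; (intro two_morphismI)?)
      (simp_all add: assms catgset_morphismD[OF q])
qed

section \<open>Weak equivalence as an equivalence relation\<close>

lemma weakly_equivalent_sym: "weakly_equivalent G X Y \<Longrightarrow> weakly_equivalent G Y X"
  unfolding weakly_equivalent_iff by blast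

text \<open>The inner pair contracts first: whiskering \<open>q0' \<circ> p0'\<close> \<cong>
  \<open>id\<close> with \<open>p0\<close> and \<open>q0\<close> reduces the fourfold composite to
  \<open>q0 \<circ> p0\<close>. Transitivity uses this twice, the second time with the roles of the
  functors exchanged.\<close>

lemma nat_iso_retraction_comp:
  assumes X: "categorified_gset G X" and Y: "categorified_gset G Y"
    and p: "catgset_morphism G X Y p0 p1" and q: "catgset_morphism G Y X q0 q1"
    and p': "catgset_morphism G Y Z p0' p1'" and q': "catgset_morphism G Z Y q0' q1'"
    and qp: "nat_iso G X X (q0 \<circ> p0) (q1 \<circ> p1) id id"
    and qp': "nat_iso G Y Y (q0' \<circ> p0') (q1' \<circ> p1') id id"
  shows "nat_iso G X X ((q0 \<circ> q0') \<circ> (p0' \<circ> p0)) ((q1 \<circ> q1') \<circ> (p1' \<circ> p1)) id id"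
proof -
  note mY = catgset_morphism_comp[OF Y p' q']
  have "nat_iso G X Y ((q0' \<circ> p0') \<circ> p0) ((q1' \<circ> p1') \<circ> p1) (id \<circ> p0) (id \<circ> p1)"
    by (rule nat_iso_whisker_right[OF X p qp'])
  then have "nat_iso G X X (q0 \<circ> ((q0' \<circ> p0') \<circ> p0)) (q1 \<circ> ((q1' \<circ> p1') \<circ> p1))
      (q0 \<circ> (id \<circ> p0)) (q1 \<circ> (id \<circ> p1))"
    using catgset_morphism_comp[OF X p mY] p q by (intro nat_iso_whisker_left[OF X]) auto
  moreover have "catgset_morphism G X X (q0 \<circ> ((q0' \<circ> p0') \<circ> p0)) (q1 \<circ> ((q1' \<circ> p1') \<circ> p1))"
    by (rule catgset_morphism_comp[OF X catgset_morphism_comp[OF X p mY] q])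
  ultimately show ?thesis
    using nat_iso_trans[OF X X _ catgset_morphism_comp[OF X p q] catgset_morphism_id _ qp]
    by (simp add: comp_assoc)
qed

lemma weakly_equivalent_trans:
  assumes X: "categorified_gset G X" and Y: "categorified_gset G Y" and Z: "categorified_gset G Z"
    and "weakly_equivalent G X Y" "weakly_equivalent G Y Z"
  shows "weakly_equivalent G X Z"
proof -
  obtain p0 p1 q0 q1 where p: "catgset_morphism G X Y p0 p1" "catgset_morphism G Y X q0 q1"
    "nat_iso G X X (q0 \<circ> p0) (q1 \<circ> p1) id id" "nat_iso G Y Y (p0 \<circ> q0) (p1 \<circ> q1) id id"
    using assms(4) unfolding weakly_equivalent_iff by blast
  obtain p0' p1' q0' q1' where p': "catgset_morphism G Y Z p0' p1'" "catgset_morphism G Z Y q0' q1'"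
    "nat_iso G Y Y (q0' \<circ> p0') (q1' \<circ> p1') id id" "nat_iso G Z Z (p0' \<circ> q0') (p1' \<circ> q1') id id"
    using assms(5) unfolding weakly_equivalent_iff by blast
  show ?thesis
    unfolding weakly_equivalent_iff
    using catgset_morphism_comp[OF X p(1) p'(1)] catgset_morphism_comp[OF Z p'(2) p(2)]
      nat_iso_retraction_comp[OF X Y p(1,2) p'(1,2) p(3) p'(3)]
      nat_iso_retraction_comp[OF Z Y p'(2,1) p(2,1) p'(4) p(4)]
    by blast
qed

text \<open>The inverse maps are again equivariant and functorial, because every point of
  \<open>Y\<close> is the image of one of \<open>X\<close>, where the functor laws of
  \<open>p0\<close>, \<open>p1\<close> apply. The semiring laws for categories all reduce to
  this.\<close>

lemma weakly_equivalent_of_iso: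
  assumes X: "categorified_gset G X" and Y: "categorified_gset G Y"
    and p: "catgset_morphism G X Y p0 p1"
    and bij: "bij_betw p0 (points (Obj X)) (points (Obj Y))"
      "bij_betw p1 (points (Arr X)) (points (Arr Y))"
  shows "weakly_equivalent G X Y"
proof -
  interpret X: categorified_gset G X by fact
  interpret Y: categorified_gset G Y by fact
  define q0 where "q0 = the_inv_into (points (Obj X)) p0"
  define q1 where "q1 = the_inv_into (points (Arr X)) p1"
  note P = catgset_morphismD[OF p]
  have q0: "q0 y = x" if "x \<in> points (Obj X)" "y = p0 x" for x y
    using that bij by (simp add: q0_def the_inv_into_f_f bij_betw_def)
  have q1: "q1 b = a" if "a \<in> points (Arr X)" "b = p1 a" for a b
    using that bij by (simp add: q1_def the_inv_into_f_f bij_betw_def)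
  have obj: "\<exists>x\<in>points (Obj X). y = p0 x" if "y \<in> points (Obj Y)" for y
    using that bij(1) by (auto simp: bij_betw_def)
  have arr: "\<exists>a\<in>points (Arr X). b = p1 a" if "b \<in> points (Arr Y)" for b
    using that bij(2) by (auto simp: bij_betw_def)
  have q: "catgset_morphism G Y X q0 q1"
  proof (rule catgset_morphismI)
    fix b c assume "b \<in> points (Arr Y)" "c \<in> points (Arr Y)" and bc: "src Y b = tgt Y c"
    then obtain a d where a: "a \<in> points (Arr X)" "b = p1 a" and d: "d \<in> points (Arr X)" "c = p1 d"
      using arr by blast
    \<comment> \<open>The endpoints are known to agree only after \<open>p0\<close>; injectivity on
      objects makes the preimages composable.\<close>
    moreover have "src X a = tgt X d"
      using inj_onD[OF bij_betw_imp_inj_on[OF bij(1)], of "src X a" "tgt X d"] a d bc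
      by (simp add: P)
    ultimately show "q1 (cmp Y b c) = cmp X (q1 b) (q1 c)"
      by (metis P(8) X.cmp_simps(1) q1)
  next
    fix y g assume "y \<in> points (Obj Y)" "g \<in> carrier G"
    then show "q0 (act (Obj Y) y g) = act (Obj X) (q0 y) g"
      by (metis P(3) X.objects.act_closed obj q0)
  next
    fix b g assume "b \<in> points (Arr Y)" "g \<in> carrier G"
    then show "q1 (act (Arr Y) b g) = act (Arr X) (q1 b) g"
      by (metis P(4) X.arrows.act_closed arr q1)
  next
    fix b assume "b \<in> points (Arr Y)"
    then obtain a where a: "a \<in> points (Arr X)" "b = p1 a"
      using arr by blast
    then show "q1 b \<in> points (Arr X)" "src X (q1 b) = q0 (src Y b)" "tgt X (q1 b) = q0 (tgt Y b)"
      by (simp_all add: a q1[OF _ refl] q0[OF _ refl] P)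
  next
    fix y assume "y \<in> points (Obj Y)"
    then obtain x where x: "x \<in> points (Obj X)" "y = p0 x"
      using obj by blast
    then show "q0 y \<in> points (Obj X)" "q1 (idn Y y) = idn X (q0 y)"
      by (simp_all add: x q0[OF _ refl] q1[OF X.idn_closed] P)
  qed
  moreover have "nat_iso G X X (q0 \<circ> p0) (q1 \<circ> p1) id id"
    by (rule nat_iso_eq[OF X X catgset_morphism_id]) (simp_all add: q0 q1)
  moreover have "nat_iso G Y Y (p0 \<circ> q0) (p1 \<circ> q1) id id"
    by (rule nat_iso_eq[OF Y Y catgset_morphism_id]) (use obj arr q0 q1 in force)+
  ultimately show ?thesis
    using p unfolding weakly_equivalent_iff by blast
qed

lemma weakly_equivalent_refl: "categorified_gset G X \<Longrightarrow> weakly_equivalent G X X"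
  by (rule weakly_equivalent_of_iso[OF _ _ catgset_morphism_id]) auto

section \<open>The categorified Burnside rig\<close>

(* The infix notation for Sum_Type.Plus clashes with the sum of cosets in HOL-Algebra. *)
lemma catgset_sum_simps [simp]:
  "points (Obj (catgset_sum X Y)) = Sum_Type.Plus (points (Obj X)) (points (Obj Y))"
  "points (Arr (catgset_sum X Y)) = Sum_Type.Plus (points (Arr X)) (points (Arr Y))"
  "act (Obj (catgset_sum X Y)) (Inl x) g = Inl (act (Obj X) x g)"
  "act (Obj (catgset_sum X Y)) (Inr y) g = Inr (act (Obj Y) y g)"
  "act (Arr (catgset_sum X Y)) (Inl a) g = Inl (act (Arr X) a g)"
  "act (Arr (catgset_sum X Y)) (Inr b) g = Inr (act (Arr Y) b g)"
  "src (catgset_sum X Y) = map_sum (src X) (src Y)"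
  "tgt (catgset_sum X Y) = map_sum (tgt X) (tgt Y)"
  "idn (catgset_sum X Y) = map_sum (idn X) (idn Y)"
  "cmp (catgset_sum X Y) (Inl a') (Inl a) = Inl (cmp X a' a)"
  "cmp (catgset_sum X Y) (Inr b') (Inr b) = Inr (cmp Y b' b)"
  by (simp_all add: catgset_sum_def gset_sum_def)

lemma catgset_prod_simps [simp]:
  "points (Obj (catgset_prod X Y)) = points (Obj X) \<times> points (Obj Y)"
  "points (Arr (catgset_prod X Y)) = points (Arr X) \<times> points (Arr Y)"
  "act (Obj (catgset_prod X Y)) (x, y) g = (act (Obj X) x g, act (Obj Y) y g)"
  "act (Arr (catgset_prod X Y)) (a, b) g = (act (Arr X) a g, act (Arr Y) b g)"
  "src (catgset_prod X Y) = map_prod (src X) (src Y)"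
  "tgt (catgset_prod X Y) = map_prod (tgt X) (tgt Y)"
  "idn (catgset_prod X Y) = map_prod (idn X) (idn Y)"
  "cmp (catgset_prod X Y) (a', b') (a, b) = (cmp X a' a, cmp Y b' b)"
  by (simp_all add: catgset_prod_def gset_prod_def)

lemma discrete_simps [simp]:
  "Obj (discrete X) = X" "Arr (discrete X) = X" "src (discrete X) = id" "tgt (discrete X) = id"
  "idn (discrete X) = id" "cmp (discrete X) b a = b"
  by (simp_all add: discrete_def)

lemma gset_empty_simps [simp]: "points gset_empty = {}" "act gset_empty x g = x"
  and gset_point_simps [simp]: "points gset_point = {()}" "act gset_point x g = x"
  by (simp_all add: gset_empty_def gset_point_def)

section \<open>Compatibility of sums and products with weak equivalence\<close>

lemma catgset_morphism_sum:
  assumes "catgset_morphism G X X' p0 p1" "catgset_morphism G Y Y' q0 q1"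
  shows "catgset_morphism G (catgset_sum X Y) (catgset_sum X' Y') (map_sum p0 q0) (map_sum p1 q1)"
  by (rule catgset_morphismI)
    (auto simp: catgset_morphismD[OF assms(1)] catgset_morphismD[OF assms(2)])

lemma catgset_morphism_prod:
  assumes "catgset_morphism G X X' p0 p1" "catgset_morphism G Y Y' q0 q1"
  shows "catgset_morphism G (catgset_prod X Y) (catgset_prod X' Y')
    (map_prod p0 q0) (map_prod p1 q1)"
  by (rule catgset_morphismI)
    (auto simp: catgset_morphismD[OF assms(1)] catgset_morphismD[OF assms(2)])

lemma two_morphism_sum:
  assumes "two_morphism G X X' p0 p1 q0 q1 t" "two_morphism G Y Y' r0 r1 s0 s1 u"
  shows "two_morphism G (catgset_sum X Y) (catgset_sum X' Y') (map_sum p0 r0) (map_sum p1 r1)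
    (map_sum q0 s0) (map_sum q1 s1) (map_sum t u)"
  by (rule two_morphismI) (auto simp: two_morphismD[OF assms(1)] two_morphismD[OF assms(2)])

lemma two_morphism_prod:
  assumes "two_morphism G X X' p0 p1 q0 q1 t" "two_morphism G Y Y' r0 r1 s0 s1 u"
  shows "two_morphism G (catgset_prod X Y) (catgset_prod X' Y') (map_prod p0 r0) (map_prod p1 r1)
    (map_prod q0 s0) (map_prod q1 s1) (map_prod t u)"
  by (rule two_morphismI) (auto simp: two_morphismD[OF assms(1)] two_morphismD[OF assms(2)])

lemma nat_iso_sum:
  assumes "nat_iso G X X' p0 p1 q0 q1" "nat_iso G Y Y' r0 r1 s0 s1"
  shows "nat_iso G (catgset_sum X Y) (catgset_sum X' Y') (map_sum p0 r0) (map_sum p1 r1)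
    (map_sum q0 s0) (map_sum q1 s1)"
proof -
  obtain t t' where t: "two_morphism G X X' p0 p1 q0 q1 t" "two_morphism G X X' q0 q1 p0 p1 t'"
    "\<forall>x\<in>points (Obj X). cmp X' (t' x) (t x) = idn X' (p0 x)"
    "\<forall>x\<in>points (Obj X). cmp X' (t x) (t' x) = idn X' (q0 x)"
    using assms(1) by (rule nat_isoE)
  obtain u u' where u: "two_morphism G Y Y' r0 r1 s0 s1 u" "two_morphism G Y Y' s0 s1 r0 r1 u'"
    "\<forall>y\<in>points (Obj Y). cmp Y' (u' y) (u y) = idn Y' (r0 y)"
    "\<forall>y\<in>points (Obj Y). cmp Y' (u y) (u' y) = idn Y' (s0 y)"
    using assms(2) by (rule nat_isoE)
  show ?thesis
    by (rule nat_isoI[OF two_morphism_sum[OF t(1) u(1)] two_morphism_sum[OF t(2) u(2)]])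
      (auto simp: t u)
qed

lemma nat_iso_prod:
  assumes "nat_iso G X X' p0 p1 q0 q1" "nat_iso G Y Y' r0 r1 s0 s1"
  shows "nat_iso G (catgset_prod X Y) (catgset_prod X' Y') (map_prod p0 r0) (map_prod p1 r1)
    (map_prod q0 s0) (map_prod q1 s1)"
proof -
  obtain t t' where t: "two_morphism G X X' p0 p1 q0 q1 t" "two_morphism G X X' q0 q1 p0 p1 t'"
    "\<forall>x\<in>points (Obj X). cmp X' (t' x) (t x) = idn X' (p0 x)"
    "\<forall>x\<in>points (Obj X). cmp X' (t x) (t' x) = idn X' (q0 x)"
    using assms(1) by (rule nat_isoE)
  obtain u u' where u: "two_morphism G Y Y' r0 r1 s0 s1 u" "two_morphism G Y Y' s0 s1 r0 r1 u'"
    "\<forall>y\<in>points (Obj Y). cmp Y' (u' y) (u y) = idn Y' (r0 y)"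
    "\<forall>y\<in>points (Obj Y). cmp Y' (u y) (u' y) = idn Y' (s0 y)"
    using assms(2) by (rule nat_isoE)
  show ?thesis
    by (rule nat_isoI[OF two_morphism_prod[OF t(1) u(1)] two_morphism_prod[OF t(2) u(2)]])
      (auto simp: t u)
qed

lemma weakly_equivalent_sum:
  assumes "weakly_equivalent G X X'" "weakly_equivalent G Y Y'"
  shows "weakly_equivalent G (catgset_sum X Y) (catgset_sum X' Y')"
proof -
  obtain p0 p1 q0 q1 where p: "catgset_morphism G X X' p0 p1" "catgset_morphism G X' X q0 q1"
    "nat_iso G X X (q0 \<circ> p0) (q1 \<circ> p1) id id" "nat_iso G X' X' (p0 \<circ> q0) (p1 \<circ> q1) id id"
    using assms(1) unfolding weakly_equivalent_iff by blast
  obtain r0 r1 s0 s1 where r: "catgset_morphism G Y Y' r0 r1" "catgset_morphism G Y' Y s0 s1"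
    "nat_iso G Y Y (s0 \<circ> r0) (s1 \<circ> r1) id id" "nat_iso G Y' Y' (r0 \<circ> s0) (r1 \<circ> s1) id id"
    using assms(2) unfolding weakly_equivalent_iff by blast
  show ?thesis
    unfolding weakly_equivalent_iff
    using catgset_morphism_sum[OF p(1) r(1)] catgset_morphism_sum[OF p(2) r(2)]
      nat_iso_sum[OF p(3) r(3)] nat_iso_sum[OF p(4) r(4)]
    \<comment> \<open>Functoriality of \<open>map_sum\<close> rewrites sums of composite functors as
      composites of sum functors, the shape that weak equivalence asks for.\<close>
    unfolding map_sum.comp[symmetric] sum.map_id0 by blast
qed

lemma weakly_equivalent_prod:
  assumes "weakly_equivalent G X X'" "weakly_equivalent G Y Y'"
  shows "weakly_equivalent G (catgset_prod X Y) (catgset_prod X' Y')"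
proof -
  obtain p0 p1 q0 q1 where p: "catgset_morphism G X X' p0 p1" "catgset_morphism G X' X q0 q1"
    "nat_iso G X X (q0 \<circ> p0) (q1 \<circ> p1) id id" "nat_iso G X' X' (p0 \<circ> q0) (p1 \<circ> q1) id id"
    using assms(1) unfolding weakly_equivalent_iff by blast
  obtain r0 r1 s0 s1 where r: "catgset_morphism G Y Y' r0 r1" "catgset_morphism G Y' Y s0 s1"
    "nat_iso G Y Y (s0 \<circ> r0) (s1 \<circ> r1) id id" "nat_iso G Y' Y' (r0 \<circ> s0) (r1 \<circ> s1) id id"
    using assms(2) unfolding weakly_equivalent_iff by blast
  show ?thesis
    unfolding weakly_equivalent_iff
    using catgset_morphism_prod[OF p(1) r(1)] catgset_morphism_prod[OF p(2) r(2)]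
      nat_iso_prod[OF p(3) r(3)] nat_iso_prod[OF p(4) r(4)]
    unfolding map_prod.comp[symmetric] prod.map_id0 by blast
qed

section \<open>Isomorphisms behind the semiring laws\<close>

fun sum_assoc :: "('x + 'y) + 'z \<Rightarrow> 'x + ('y + 'z)" where
  "sum_assoc (Inl (Inl x)) = Inl x"
| "sum_assoc (Inl (Inr y)) = Inr (Inl y)"
| "sum_assoc (Inr z) = Inr (Inr z)"

fun sum_swap :: "'x + 'y \<Rightarrow> 'y + 'x" where
  "sum_swap (Inl x) = Inr x"
| "sum_swap (Inr y) = Inl y"

fun prod_assoc :: "('x \<times> 'y) \<times> 'z \<Rightarrow> 'x \<times> ('y \<times> 'z)" where
  "prod_assoc ((x, y), z) = (x, (y, z))"

fun sum_prod_distr :: "('x + 'y) \<times> 'z \<Rightarrow> 'x \<times> 'z + 'y \<times> 'z" where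
  "sum_prod_distr (Inl x, z) = Inl (x, z)"
| "sum_prod_distr (Inr y, z) = Inr (y, z)"

lemma bij_sum_assoc:
  "bij_betw sum_assoc (Sum_Type.Plus (Sum_Type.Plus A B) C) (Sum_Type.Plus A (Sum_Type.Plus B C))"
  by (rule bij_betw_byWitness[where f' = "case_sum (Inl \<circ> Inl) (case_sum (Inl \<circ> Inr) Inr)"]) auto

lemma bij_sum_swap: "bij_betw sum_swap (Sum_Type.Plus A B) (Sum_Type.Plus B A)"
  by (rule bij_betw_byWitness[where f' = sum_swap]) auto

lemma bij_prod_assoc: "bij_betw prod_assoc ((A \<times> B) \<times> C) (A \<times> (B \<times> C))"
  by (rule bij_betw_byWitness[where f' = "\<lambda>(x, (y, z)). ((x, y), z)"]) auto

lemma bij_prod_swap: "bij_betw prod.swap (A \<times> B) (B \<times> A)"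
  by (rule bij_betw_byWitness[where f' = prod.swap]) auto

lemma bij_sum_prod_distr:
  "bij_betw sum_prod_distr (Sum_Type.Plus A B \<times> C) (Sum_Type.Plus (A \<times> C) (B \<times> C))"
  by (rule bij_betw_byWitness[where f' = "case_sum (map_prod Inl id) (map_prod Inr id)"]) auto

text \<open>The left summand is empty, so the branch \<open>undefined\<close> is never evaluated on
  the domain.\<close>

lemma bij_sum_empty: "bij_betw (case_sum undefined id) (Sum_Type.Plus {} A) A"
  by (rule bij_betw_byWitness[where f' = Inr]) auto

lemma bij_prod_point: "bij_betw snd ({()} \<times> A) A"
  by (rule bij_betw_byWitness[where f' = "Pair ()"]) auto

lemma catgset_sum_assoc:
  assumes "categorified_gset G X" "categorified_gset G Y" "categorified_gset G Z"
  shows "weakly_equivalent G (catgset_sum (catgset_sum X Y) Z) (catgset_sum X (catgset_sum Y Z))"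
  by (rule weakly_equivalent_of_iso[where ?p0.0 = sum_assoc and ?p1.0 = sum_assoc])
    (auto intro!: categorified_gset_sum assms catgset_morphismI bij_sum_assoc)

lemma catgset_sum_comm:
  assumes "categorified_gset G X" "categorified_gset G Y"
  shows "weakly_equivalent G (catgset_sum X Y) (catgset_sum Y X)"
  by (rule weakly_equivalent_of_iso[where ?p0.0 = sum_swap and ?p1.0 = sum_swap])
    (auto intro!: categorified_gset_sum assms catgset_morphismI bij_sum_swap)

lemma catgset_sum_empty:
  assumes "categorified_gset G X"
  shows "weakly_equivalent G (catgset_sum (discrete gset_empty) X) X"
proof -
  interpret categorified_gset G X by fact
  show ?thesis
    by (intro weakly_equivalent_of_iso[where ?p0.0 = "case_sum undefined id" and
          ?p1.0 = "case_sum undefined id"])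
      (auto intro!: categorified_gset_sum categorified_gset_discrete right_gset_empty assms
        objects.group_axioms catgset_morphismI bij_sum_empty)
qed

lemma catgset_prod_assoc:
  assumes "categorified_gset G X" "categorified_gset G Y" "categorified_gset G Z"
  shows "weakly_equivalent G (catgset_prod (catgset_prod X Y) Z) (catgset_prod X (catgset_prod Y Z))"
  by (rule weakly_equivalent_of_iso[where ?p0.0 = prod_assoc and ?p1.0 = prod_assoc])
    (auto intro!: categorified_gset_prod assms catgset_morphismI bij_prod_assoc)

lemma catgset_prod_comm:
  assumes "categorified_gset G X" "categorified_gset G Y"
  shows "weakly_equivalent G (catgset_prod X Y) (catgset_prod Y X)"
  by (rule weakly_equivalent_of_iso[where ?p0.0 = prod.swap and ?p1.0 = prod.swap])
    (auto intro!: categorified_gset_prod assms catgset_morphismI bij_prod_swap)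

lemma catgset_prod_point:
  assumes "categorified_gset G X"
  shows "weakly_equivalent G (catgset_prod (discrete gset_point) X) X"
proof -
  interpret categorified_gset G X by fact
  show ?thesis
    by (intro weakly_equivalent_of_iso[where ?p0.0 = snd and ?p1.0 = snd])
      (auto intro!: categorified_gset_prod categorified_gset_discrete right_gset_point assms
        objects.group_axioms catgset_morphismI bij_prod_point)
qed

text \<open>Neither side has an object or an arrow, so the functor laws are vacuous and
  \<open>fst\<close> merely has the right type.\<close>

lemma catgset_prod_empty:
  assumes "categorified_gset G X"
  shows "weakly_equivalent G (catgset_prod (discrete gset_empty) X) (discrete gset_empty)"
proof -
  interpret categorified_gset G X by fact
  show ?thesis
    by (intro weakly_equivalent_of_iso[where ?p0.0 = fst and ?p1.0 = fst])
      (auto intro!: categorified_gset_prod categorified_gset_discrete right_gset_empty assms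
        objects.group_axioms catgset_morphismI simp: bij_betw_def)
qed

lemma catgset_sum_prod_distr:
  assumes "categorified_gset G X" "categorified_gset G Y" "categorified_gset G Z"
  shows "weakly_equivalent G (catgset_prod (catgset_sum X Y) Z)
    (catgset_sum (catgset_prod X Z) (catgset_prod Y Z))"
  by (rule weakly_equivalent_of_iso[where ?p0.0 = sum_prod_distr and ?p1.0 = sum_prod_distr])
    (auto intro!: categorified_gset_sum categorified_gset_prod assms catgset_morphismI
      bij_sum_prod_distr)

text \<open>\<open>finite_gsets\<close> and \<open>finite_catgsets\<close> are confined to natural
  numbers, but sums, products and \<open>pi0\<close> leave that type. Finiteness is therefore
  restated for structures on arbitrary types, here and in \<open>fin_catgset\<close>.\<close>

definition fin_gset :: "('g, 'm) monoid_scheme \<Rightarrow> ('x, 'g) gset \<Rightarrow> bool" where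
  "fin_gset G X \<longleftrightarrow> right_gset G X \<and> finite (points X)"

definition fin_catgset :: "('g, 'm) monoid_scheme \<Rightarrow> ('o, 'a, 'g) catgset \<Rightarrow> bool" where
  "fin_catgset G X \<longleftrightarrow> categorified_gset G X \<and> finite (points (Arr X))"

lemma fin_catgset_sum:
  "\<lbrakk>fin_catgset G X; fin_catgset G Y\<rbrakk> \<Longrightarrow> fin_catgset G (catgset_sum X Y)"
  by (simp add: fin_catgset_def categorified_gset_sum)

lemma fin_catgset_prod:
  "\<lbrakk>fin_catgset G X; fin_catgset G Y\<rbrakk> \<Longrightarrow> fin_catgset G (catgset_prod X Y)"
  by (simp add: fin_catgset_def categorified_gset_prod)

lemma fin_catgset_discrete:
  "fin_gset G X \<Longrightarrow> fin_catgset G (discrete X)"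
  by (simp add: fin_gset_def fin_catgset_def categorified_gset_discrete)

section \<open>Classes of finite categorified \<open>G\<close>-sets and their operations\<close>

lemma catgset_class_eqI:
  fixes G :: "('g, 'm) monoid_scheme"
  assumes "categorified_gset G X" "categorified_gset G Y" "weakly_equivalent G X Y"
  shows "catgset_class G X = catgset_class G Y"
proof -
  have "weakly_equivalent G X Z \<longleftrightarrow> weakly_equivalent G Y Z" if "categorified_gset G Z"
    for Z :: "(nat, nat, 'g) catgset"
    using weakly_equivalent_trans[OF assms(1,2) that assms(3)]
      weakly_equivalent_trans[OF assms(2,1) that weakly_equivalent_sym[OF assms(3)]] by blast
  then show ?thesis
    by (auto simp: catgset_class_def finite_catgsets_def)
qed

text \<open>A class is nonempty even if \<open>X\<close> lives on another type, as sums and products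
  do; this keeps unions over classes from being empty.\<close>

lemma catgset_class_rep:
  assumes "fin_catgset G X"
  obtains Z where "Z \<in> catgset_class G X" "catgset_class G Z = catgset_class G X"
proof -
  obtain Z where "Z \<in> finite_catgsets G" "weakly_equivalent G X Z"
    using assms finite_catgset_represented unfolding fin_catgset_def by blast
  with that[of Z] catgset_class_eqI[of G X Z] assms show ?thesis
    by (simp add: catgset_class_def finite_catgsets_def fin_catgset_def)
qed

lemma catgset_class_carrier:
  assumes "fin_catgset G X"
  shows "catgset_class G X \<in> carrier (cat_burnside_rig G)"
proof -
  obtain Z where "Z \<in> catgset_class G X" "catgset_class G Z = catgset_class G X"
    using assms by (rule catgset_class_rep)
  then show ?thesis
    by (auto simp: cat_burnside_rig_def catgset_class_def intro!: image_eqI[of _ _ Z])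
qed

lemma cat_burnside_carrierE:
  fixes G :: "('g, 'm) monoid_scheme"
  assumes "A \<in> carrier (cat_burnside_rig G)"
  obtains X :: "(nat, nat, 'g) catgset" where "fin_catgset G X" "A = catgset_class G X"
  using assms by (auto simp: cat_burnside_rig_def finite_catgsets_def fin_catgset_def)

lemma UN_catgset_class:
  assumes "fin_catgset G X"
    and "\<And>Z. \<lbrakk>Z \<in> catgset_class G X; fin_catgset G Z; weakly_equivalent G X Z\<rbrakk> \<Longrightarrow> F Z = C"
  shows "(\<Union>Z\<in>catgset_class G X. F Z) = C"
proof -
  have "F Z = C" if "Z \<in> catgset_class G X" for Z
    using that assms(2)[of Z]
    by (simp add: catgset_class_def finite_catgsets_def fin_catgset_def)
  moreover obtain Z where "Z \<in> catgset_class G X"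
    using assms(1) by (rule catgset_class_rep)
  ultimately show ?thesis
    by auto
qed

lemma cat_burnside_add:
  assumes "fin_catgset G X" "fin_catgset G Y"
  shows "catgset_class G X \<oplus>\<^bsub>cat_burnside_rig G\<^esub> catgset_class G Y
    = catgset_class G (catgset_sum X Y)"
  unfolding cat_burnside_rig_def ring.simps
proof (intro UN_catgset_class assms)
  fix X' Y'
  assume X': "fin_catgset G X'" "weakly_equivalent G X X'"
    and Y': "fin_catgset G Y'" "weakly_equivalent G Y Y'"
  show "catgset_class G (catgset_sum X' Y') = catgset_class G (catgset_sum X Y)"
    using X' Y' assms weakly_equivalent_sym[OF weakly_equivalent_sum[OF X'(2) Y'(2)]]
    by (intro catgset_class_eqI) (simp_all add: fin_catgset_def categorified_gset_sum)
qed

lemma cat_burnside_mult: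
  assumes "fin_catgset G X" "fin_catgset G Y"
  shows "catgset_class G X \<otimes>\<^bsub>cat_burnside_rig G\<^esub> catgset_class G Y
    = catgset_class G (catgset_prod X Y)"
  unfolding cat_burnside_rig_def ring.simps monoid.simps
proof (intro UN_catgset_class assms)
  fix X' Y'
  assume X': "fin_catgset G X'" "weakly_equivalent G X X'"
    and Y': "fin_catgset G Y'" "weakly_equivalent G Y Y'"
  show "catgset_class G (catgset_prod X' Y') = catgset_class G (catgset_prod X Y)"
    using X' Y' assms weakly_equivalent_sym[OF weakly_equivalent_prod[OF X'(2) Y'(2)]]
    by (intro catgset_class_eqI) (simp_all add: fin_catgset_def categorified_gset_prod)
qed

lemma cat_burnside_zero: "\<zero>\<^bsub>cat_burnside_rig G\<^esub> = catgset_class G (discrete gset_empty)"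
  and cat_burnside_one: "\<one>\<^bsub>cat_burnside_rig G\<^esub> = catgset_class G (discrete gset_point)"
  by (simp_all add: cat_burnside_rig_def)

theorem cat_burnside_rig_rig:
  assumes "group G"
  shows "rig (cat_burnside_rig G)"
proof -
  have fin: "fin_catgset G (discrete gset_empty)" "fin_catgset G (discrete gset_point)"
    using assms
    by (simp_all add: fin_catgset_discrete fin_gset_def right_gset_empty right_gset_point)
  note simps = cat_burnside_add cat_burnside_mult cat_burnside_zero cat_burnside_one
    fin_catgset_sum fin_catgset_prod fin catgset_class_carrier
  have cat: "categorified_gset G X" if "fin_catgset G X" for X
    using that by (simp add: fin_catgset_def)
  note iso = catgset_sum_assoc catgset_sum_comm catgset_sum_empty
    catgset_prod_assoc catgset_prod_comm catgset_prod_point catgset_prod_empty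
    catgset_sum_prod_distr
  \<comment> \<open>Rotating the premises puts the weak equivalence first, so that each isomorphism
    becomes an equality of classes.\<close>
  note class_eq = iso[THEN catgset_class_eqI[rotated 2]]
  show ?thesis
    by (intro rigI abelian_monoidI comm_monoidI; (elim cat_burnside_carrierE)?; simp add: simps)
      (rule class_eq; simp add: simps cat)+
qed

section \<open>Classes of finite G-sets\<close>

lemma gset_iso_sym:
  assumes "right_gset G X" "gset_iso G X Y"
  shows "gset_iso G Y X"
proof -
  interpret right_gset G X by fact
  obtain f where f: "equivariant G X Y f" "bij_betw f (points X) (points Y)"
    using assms(2) by (auto simp: gset_iso_def)
  define k where "k = the_inv_into (points X) f"
  have k: "k (f x) = x" if "x \<in> points X" for x
    using f(2) that by (simp add: k_def the_inv_into_f_f bij_betw_def)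
  have surj: "\<exists>x\<in>points X. y = f x" if "y \<in> points Y" for y
    using that f(2) by (auto simp: bij_betw_def)
  have "equivariant G Y X k"
    unfolding equivariant_def
  proof (intro conjI ballI funcsetI)
    fix y assume "y \<in> points Y"
    then obtain x where x: "x \<in> points X" "y = f x"
      using surj by blast
    then show "k y \<in> points X"
      by (simp add: k)
    fix g assume g: "g \<in> carrier G"
    then have "act Y y g = f (act X x g)"
      using f(1) x by (simp add: equivariant_def)
    then show "k (act Y y g) = act X (k y) g"
      using x g by (simp add: k act_closed)
  qed
  moreover have "bij_betw k (points Y) (points X)"
    unfolding k_def by (rule bij_betw_the_inv_into[OF f(2)])
  ultimately show ?thesis
    by (auto simp: gset_iso_def)
qed

lemma gset_iso_trans:
  assumes "gset_iso G X Y" "gset_iso G Y Z"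
  shows "gset_iso G X Z"
proof -
  obtain f h where "equivariant G X Y f" "bij_betw f (points X) (points Y)"
    "equivariant G Y Z h" "bij_betw h (points Y) (points Z)"
    using assms by (auto simp: gset_iso_def)
  then have "equivariant G X Z (h \<circ> f)" "bij_betw (h \<circ> f) (points X) (points Z)"
    by (auto simp: equivariant_def Pi_iff intro: bij_betw_trans)
  then show ?thesis
    by (auto simp: gset_iso_def)
qed

lemma gset_sum_simps [simp]:
  "points (gset_sum X Y) = Sum_Type.Plus (points X) (points Y)"
  "act (gset_sum X Y) (Inl x) g = Inl (act X x g)"
  "act (gset_sum X Y) (Inr y) g = Inr (act Y y g)"
  by (simp_all add: gset_sum_def)

lemma gset_prod_simps [simp]:
  "points (gset_prod X Y) = points X \<times> points Y"
  "act (gset_prod X Y) (x, y) g = (act X x g, act Y y g)"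
  by (simp_all add: gset_prod_def)

lemma gset_iso_sum:
  assumes "gset_iso G X X'" "gset_iso G Y Y'"
  shows "gset_iso G (gset_sum X Y) (gset_sum X' Y')"
proof -
  obtain f h where f: "equivariant G X X' f" "bij_betw f (points X) (points X')"
    and h: "equivariant G Y Y' h" "bij_betw h (points Y) (points Y')"
    using assms by (auto simp: gset_iso_def)
  have "equivariant G (gset_sum X Y) (gset_sum X' Y') (map_sum f h)"
    using f(1) h(1) by (auto simp: equivariant_def)
  moreover have "bij_betw (map_sum f h) (points (gset_sum X Y)) (points (gset_sum X' Y'))"
    by (rule bij_betw_byWitness[where
          f' = "map_sum (the_inv_into (points X) f) (the_inv_into (points Y) h)"])
      (use f h in \<open>auto simp: bij_betw_def the_inv_into_f_f f_the_inv_into_f the_inv_into_into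
        image_subset_iff\<close>)
  ultimately show ?thesis
    by (auto simp: gset_iso_def)
qed

lemma gset_iso_prod:
  assumes "gset_iso G X X'" "gset_iso G Y Y'"
  shows "gset_iso G (gset_prod X Y) (gset_prod X' Y')"
proof -
  obtain f h where f: "equivariant G X X' f" "bij_betw f (points X) (points X')"
    and h: "equivariant G Y Y' h" "bij_betw h (points Y) (points Y')"
    using assms by (auto simp: gset_iso_def)
  have "equivariant G (gset_prod X Y) (gset_prod X' Y') (map_prod f h)"
    using f(1) h(1) by (auto simp: equivariant_def)
  moreover have "bij_betw (map_prod f h) (points (gset_prod X Y)) (points (gset_prod X' Y'))"
    using bij_betw_map_prod[OF f(2) h(2)] by simp
  ultimately show ?thesis
    by (auto simp: gset_iso_def)
qed

lemma fin_gset_sum: "\<lbrakk>fin_gset G X; fin_gset G Y\<rbrakk> \<Longrightarrow> fin_gset G (gset_sum X Y)"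
  by (simp add: fin_gset_def right_gset_sum)

lemma fin_gset_prod: "\<lbrakk>fin_gset G X; fin_gset G Y\<rbrakk> \<Longrightarrow> fin_gset G (gset_prod X Y)"
  by (simp add: fin_gset_def right_gset_prod)

lemma gset_class_eqI:
  assumes "right_gset G X" "gset_iso G X Y"
  shows "gset_class G X = gset_class G Y"
  using gset_iso_trans[OF assms(2)] gset_iso_trans[OF gset_iso_sym[OF assms]]
  by (auto simp: gset_class_def)

lemma gset_class_rep:
  assumes "fin_gset G X"
  obtains Z where "Z \<in> gset_class G X" "gset_class G Z = gset_class G X"
proof -
  obtain Z where "Z \<in> finite_gsets G" "gset_iso G X Z"
    using assms finite_gset_represented unfolding fin_gset_def by blast
  with that[of Z] gset_class_eqI[of G X Z] assms show ?thesis
    by (simp add: gset_class_def fin_gset_def)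
qed

lemma gset_class_carrier:
  assumes "fin_gset G X"
  shows "gset_class G X \<in> carrier (burnside_rig G)"
proof -
  obtain Z where "Z \<in> gset_class G X" "gset_class G Z = gset_class G X"
    using assms by (rule gset_class_rep)
  then show ?thesis
    by (auto simp: burnside_rig_def gset_class_def intro!: image_eqI[of _ _ Z])
qed

lemma burnside_carrierE:
  fixes G :: "('g, 'm) monoid_scheme"
  assumes "A \<in> carrier (burnside_rig G)"
  obtains X :: "(nat, 'g) gset" where "fin_gset G X" "A = gset_class G X"
  using assms by (auto simp: burnside_rig_def finite_gsets_def fin_gset_def)

lemma UN_gset_class:
  assumes "fin_gset G X"
    and "\<And>Z. \<lbrakk>Z \<in> gset_class G X; fin_gset G Z; gset_iso G X Z\<rbrakk> \<Longrightarrow> F Z = C"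
  shows "(\<Union>Z\<in>gset_class G X. F Z) = C"
proof -
  have "F Z = C" if "Z \<in> gset_class G X" for Z
    using that assms(2)[of Z] by (simp add: gset_class_def finite_gsets_def fin_gset_def)
  moreover obtain Z where "Z \<in> gset_class G X"
    using assms(1) by (rule gset_class_rep)
  ultimately show ?thesis
    by auto
qed

lemma burnside_add:
  assumes "fin_gset G X" "fin_gset G Y"
  shows "gset_class G X \<oplus>\<^bsub>burnside_rig G\<^esub> gset_class G Y = gset_class G (gset_sum X Y)"
  unfolding burnside_rig_def ring.simps
proof (intro UN_gset_class assms)
  fix X' Y'
  assume "gset_iso G X X'" "gset_iso G Y Y'"
  then show "gset_class G (gset_sum X' Y') = gset_class G (gset_sum X Y)"
    using gset_class_eqI[OF _ gset_iso_sum] assms by (metis fin_gset_def right_gset_sum)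
qed

lemma burnside_mult:
  assumes "fin_gset G X" "fin_gset G Y"
  shows "gset_class G X \<otimes>\<^bsub>burnside_rig G\<^esub> gset_class G Y = gset_class G (gset_prod X Y)"
  unfolding burnside_rig_def ring.simps monoid.simps
proof (intro UN_gset_class assms)
  fix X' Y'
  assume "gset_iso G X X'" "gset_iso G Y Y'"
  then show "gset_class G (gset_prod X' Y') = gset_class G (gset_prod X Y)"
    using gset_class_eqI[OF _ gset_iso_prod] assms by (metis fin_gset_def right_gset_prod)
qed

lemma burnside_zero: "\<zero>\<^bsub>burnside_rig G\<^esub> = gset_class G gset_empty"
  and burnside_one: "\<one>\<^bsub>burnside_rig G\<^esub> = gset_class G gset_point"
  by (simp_all add: burnside_rig_def)

section \<open>Isomorphism classes of objects and non-invertible arrows\<close>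

definition inverse_arrows :: "('o, 'a, 'g) catgset \<Rightarrow> 'a \<Rightarrow> 'a \<Rightarrow> bool" where
  "inverse_arrows X a b \<longleftrightarrow> a \<in> points (Arr X) \<and> b \<in> points (Arr X) \<and>
     src X b = tgt X a \<and> tgt X b = src X a \<and>
     cmp X b a = idn X (src X a) \<and> cmp X a b = idn X (tgt X a)"

definition invertible_arrow :: "('o, 'a, 'g) catgset \<Rightarrow> 'a \<Rightarrow> bool" where
  "invertible_arrow X a \<longleftrightarrow> (\<exists>b. inverse_arrows X a b)"

definition isomorphic_objs :: "('o, 'a, 'g) catgset \<Rightarrow> 'o \<Rightarrow> 'o \<Rightarrow> bool" where
  "isomorphic_objs X x y \<longleftrightarrow> (\<exists>a. invertible_arrow X a \<and> src X a = x \<and> tgt X a = y)"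

definition iso_class :: "('o, 'a, 'g) catgset \<Rightarrow> 'o \<Rightarrow> 'o set" where
  "iso_class X x = {y \<in> points (Obj X). isomorphic_objs X x y}"

text \<open>These are the components of the maximal subgroupoid, not those of the category itself.
  The union in the action avoids choosing a representative: isomorphic objects have isomorphic
  translates, so on a class all its terms coincide.\<close>

definition pi0 :: "('o, 'a, 'g) catgset \<Rightarrow> ('o set, 'g) gset" where
  "pi0 X = \<lparr>points = iso_class X ` points (Obj X),
     act = \<lambda>C g. \<Union>x\<in>C. iso_class X (act (Obj X) x g)\<rparr>"

definition nonrigid :: "('o, 'a, 'g) catgset \<Rightarrow> 'o set" where
  "nonrigid X = src X ` {a \<in> points (Arr X). \<not> invertible_arrow X a}"

text \<open>The action does not enter: this is an invariant of the underlying category.\<close>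

definition nonrigid_count :: "('o, 'a, 'g) catgset \<Rightarrow> nat" where
  "nonrigid_count X = card (iso_class X ` nonrigid X)"

lemma points_pi0 [simp]: "points (pi0 X) = iso_class X ` points (Obj X)"
  by (simp add: pi0_def)

lemma inverse_arrows_sym: "inverse_arrows X a b \<Longrightarrow> inverse_arrows X b a"
  by (auto simp: inverse_arrows_def)

context categorified_gset
begin

lemma inverse_arrows_cmp:
  assumes "inverse_arrows X a b" "inverse_arrows X c d" "src X c = tgt X a"
  shows "inverse_arrows X (cmp X c a) (cmp X b d)"
  using assms by (simp add: inverse_arrows_def assoc cmp_cancel)

lemma invertible_arrow_cmp:
  assumes "invertible_arrow X a" "invertible_arrow X c" "src X c = tgt X a"
  shows "invertible_arrow X (cmp X c a)"
  using assms inverse_arrows_cmp unfolding invertible_arrow_def by blast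

lemma isomorphic_objs_refl: "x \<in> points (Obj X) \<Longrightarrow> isomorphic_objs X x x"
  unfolding isomorphic_objs_def invertible_arrow_def inverse_arrows_def
  by (intro exI[of _ "idn X x"] conjI) simp_all

lemma isomorphic_objs_sym: "isomorphic_objs X x y \<Longrightarrow> isomorphic_objs X y x"
  unfolding isomorphic_objs_def invertible_arrow_def
  by (metis inverse_arrows_def inverse_arrows_sym)

lemma isomorphic_objs_trans:
  assumes "isomorphic_objs X x y" "isomorphic_objs X y z"
  shows "isomorphic_objs X x z"
proof -
  obtain a c where "invertible_arrow X a" "src X a = x" "tgt X a = y"
    "invertible_arrow X c" "src X c = y" "tgt X c = z"
    using assms by (auto simp: isomorphic_objs_def)
  moreover from this have "a \<in> points (Arr X)" "c \<in> points (Arr X)"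
    by (auto simp: invertible_arrow_def inverse_arrows_def)
  ultimately show ?thesis
    unfolding isomorphic_objs_def
    by (intro exI[of _ "cmp X c a"]) (simp add: invertible_arrow_cmp)
qed

lemma isomorphic_objs_act:
  assumes "isomorphic_objs X x y" "g \<in> carrier G"
  shows "isomorphic_objs X (act (Obj X) x g) (act (Obj X) y g)"
proof -
  obtain a b where ab: "inverse_arrows X a b" "src X a = x" "tgt X a = y"
    using assms(1) by (auto simp: isomorphic_objs_def invertible_arrow_def)
  then have "inverse_arrows X (act (Arr X) a g) (act (Arr X) b g)"
    using assms(2) by (auto simp: inverse_arrows_def)
  moreover have "src X (act (Arr X) a g) = act (Obj X) x g" "tgt X (act (Arr X) a g) = act (Obj X) y g"
    using ab assms(2) by (auto simp: inverse_arrows_def)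
  ultimately show ?thesis
    unfolding isomorphic_objs_def invertible_arrow_def by blast
qed

lemma iso_class_eq_iff:
  assumes "x \<in> points (Obj X)" "y \<in> points (Obj X)"
  shows "iso_class X x = iso_class X y \<longleftrightarrow> isomorphic_objs X x y"
proof
  assume "iso_class X x = iso_class X y"
  moreover have "y \<in> iso_class X y"
    using assms by (simp add: iso_class_def isomorphic_objs_refl)
  ultimately show "isomorphic_objs X x y"
    by (auto simp: iso_class_def)
next
  assume "isomorphic_objs X x y"
  then show "iso_class X x = iso_class X y"
    using isomorphic_objs_trans isomorphic_objs_sym unfolding iso_class_def by blast
qed

lemma iso_class_self: "x \<in> points (Obj X) \<Longrightarrow> x \<in> iso_class X x"
  by (simp add: iso_class_def isomorphic_objs_refl)

lemma act_pi0:
  assumes "x \<in> points (Obj X)" "g \<in> carrier G"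
  shows "act (pi0 X) (iso_class X x) g = iso_class X (act (Obj X) x g)"
proof -
  have eq: "iso_class X (act (Obj X) y g) = iso_class X (act (Obj X) x g)"
    if "y \<in> iso_class X x" for y
  proof -
    have y: "y \<in> points (Obj X)" "isomorphic_objs X y x"
      using that by (simp_all add: iso_class_def isomorphic_objs_sym)
    show ?thesis
      using isomorphic_objs_act[OF y(2) assms(2)] y(1) assms by (simp add: iso_class_eq_iff)
  qed
  have "act (pi0 X) (iso_class X x) g = (\<Union>y\<in>iso_class X x. iso_class X (act (Obj X) y g))"
    by (simp add: pi0_def)
  also have "\<dots> = (\<Union>y\<in>iso_class X x. iso_class X (act (Obj X) x g))"
    by (rule SUP_cong) (simp_all add: eq)
  also have "\<dots> = iso_class X (act (Obj X) x g)"
    using iso_class_self[OF assms(1)] by auto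
  finally show ?thesis .
qed

lemma right_gset_pi0: "right_gset G (pi0 X)"
proof (intro right_gset.intro right_gset_axioms.intro objects.group_axioms)
  fix C assume "C \<in> points (pi0 X)"
  then obtain x where x: "x \<in> points (Obj X)" "C = iso_class X x"
    by (auto simp: pi0_def)
  show "act (pi0 X) C \<one> = C"
    using x by (simp add: act_pi0 objects.act_one)
  fix g assume g: "g \<in> carrier G"
  then show "act (pi0 X) C g \<in> points (pi0 X)"
    using x act_pi0[OF x(1) g] by (simp add: pi0_def)
  fix h assume "h \<in> carrier G"
  then show "act (pi0 X) C (g \<otimes> h) = act (pi0 X) (act (pi0 X) C g) h"
    using x g by (simp add: act_pi0 objects.act_mult)
qed

text \<open>Every object is the source of its identity, so the arrows bound the objects.\<close>

lemma finite_objects: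
  assumes "finite (points (Arr X))"
  shows "finite (points (Obj X))"
proof (rule finite_surj[OF assms])
  show "points (Obj X) \<subseteq> src X ` points (Arr X)"
  proof
    fix x assume "x \<in> points (Obj X)"
    then show "x \<in> src X ` points (Arr X)"
      by (intro image_eqI[of _ _ "idn X x"]) simp_all
  qed
qed

lemma nonrigid_subset: "nonrigid X \<subseteq> points (Obj X)"
  by (auto simp: nonrigid_def)

text \<open>Universal property of the quotient: an equivariant surjection whose fibres are the
  isomorphism classes identifies \<open>pi0 X\<close> with its target. Invariance, sums and discrete
  categories are all handled by choosing \<open>h\<close>.\<close>

lemma pi0_gset_isoI:
  assumes h: "equivariant G (Obj X) Z h" "h ` points (Obj X) = points Z"
    and ker: "\<And>x y. \<lbrakk>x \<in> points (Obj X); y \<in> points (Obj X)\<rbrakk>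
      \<Longrightarrow> h x = h y \<longleftrightarrow> isomorphic_objs X x y"
  shows "gset_iso G (pi0 X) Z"
proof -
  \<comment> \<open>By \<open>ker\<close>, \<open>h\<close> is constant on each isomorphism class,
    so the choice does not affect the value.\<close>
  define f where "f C = h (SOME x. x \<in> C)" for C
  have f: "f (iso_class X x) = h x" if x: "x \<in> points (Obj X)" for x
  proof -
    define y where "y = (SOME y. y \<in> iso_class X x)"
    have "y \<in> iso_class X x"
      unfolding y_def using iso_class_self[OF x] by (rule someI)
    then have "h x = h y"
      using ker[OF x] by (simp add: iso_class_def)
    then show ?thesis
      by (simp add: f_def y_def)
  qed
  have "equivariant G (pi0 X) Z f"
    using h by (auto simp: equivariant_def f act_pi0 Pi_iff)
  moreover have "bij_betw f (points (pi0 X)) (points Z)"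
    unfolding bij_betw_def
  proof
    show "inj_on f (points (pi0 X))"
      by (simp add: inj_on_def f ker iso_class_eq_iff)
    show "f ` points (pi0 X) = points Z"
      using h(2) by (simp add: f image_image)
  qed
  ultimately show ?thesis
    by (auto simp: gset_iso_def)
qed

end

section \<open>Invariance under weak equivalence\<close>

lemma inverse_arrows_morphism:
  assumes "categorified_gset G X" "catgset_morphism G X Y p0 p1" "inverse_arrows X a b"
  shows "inverse_arrows Y (p1 a) (p1 b)"
proof -
  interpret categorified_gset G X by fact
  show ?thesis
    using assms(3)
    by (simp add: inverse_arrows_def catgset_morphismD(1-7)[OF assms(2)]
        catgset_morphismD(8)[OF assms(2), symmetric])
qed

lemma invertible_arrow_morphism:
  assumes "categorified_gset G X" "catgset_morphism G X Y p0 p1" "invertible_arrow X a"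
  shows "invertible_arrow Y (p1 a)"
  using inverse_arrows_morphism[OF assms(1,2)] assms(3) by (auto simp: invertible_arrow_def)

lemma isomorphic_objs_morphism:
  assumes X: "categorified_gset G X" and p: "catgset_morphism G X Y p0 p1"
    and "isomorphic_objs X x y"
  shows "isomorphic_objs Y (p0 x) (p0 y)"
proof -
  obtain a where a: "invertible_arrow X a" "src X a = x" "tgt X a = y"
    using assms(3) by (auto simp: isomorphic_objs_def)
  then have "a \<in> points (Arr X)"
    by (auto simp: invertible_arrow_def inverse_arrows_def)
  then show ?thesis
    using invertible_arrow_morphism[OF X p a(1)] a(2,3) catgset_morphismD(5,6)[OF p]
    unfolding isomorphic_objs_def by blast
qed

lemma nat_iso_component:
  assumes "nat_iso G X X f0 f1 id id"
  obtains t where "\<And>x. x \<in> points (Obj X) \<Longrightarrow>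
      invertible_arrow X (t x) \<and> src X (t x) = f0 x \<and> tgt X (t x) = x"
    and "\<And>a. a \<in> points (Arr X) \<Longrightarrow> cmp X (t (tgt X a)) (f1 a) = cmp X a (t (src X a))"
proof -
  obtain t s where t: "two_morphism G X X f0 f1 id id t" "two_morphism G X X id id f0 f1 s"
    "\<forall>x\<in>points (Obj X). cmp X (s x) (t x) = idn X (f0 x)"
    "\<forall>x\<in>points (Obj X). cmp X (t x) (s x) = idn X (id x)"
    using assms by (rule nat_isoE)
  have "inverse_arrows X (t x) (s x)" if "x \<in> points (Obj X)" for x
    using that t(3,4)
    by (simp add: inverse_arrows_def two_morphismD[OF t(1)] two_morphismD[OF t(2)])
  then show ?thesis
    using that[of t] two_morphismD[OF t(1)] by (auto simp: invertible_arrow_def)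
qed

lemma nat_iso_isomorphic_objs:
  assumes "nat_iso G X X f0 f1 id id" "x \<in> points (Obj X)"
  shows "isomorphic_objs X (f0 x) x"
  using assms by (elim nat_iso_component) (auto simp: isomorphic_objs_def)

text \<open>Functors preserve isomorphism. For reflection, \<open>q0\<close> carries it back to
  \<open>X\<close>, where the natural isomorphism links \<open>q0 (p0 x)\<close> with
  \<open>x\<close> and \<open>q0 (p0 y)\<close> with \<open>y\<close>.\<close>

lemma equivalence_isomorphic_objs_iff:
  assumes X: "categorified_gset G X" and Y: "categorified_gset G Y"
    and p: "catgset_morphism G X Y p0 p1" and q: "catgset_morphism G Y X q0 q1"
    and qp: "nat_iso G X X (q0 \<circ> p0) (q1 \<circ> p1) id id"
    and xy: "x \<in> points (Obj X)" "y \<in> points (Obj X)"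
  shows "isomorphic_objs Y (p0 x) (p0 y) \<longleftrightarrow> isomorphic_objs X x y"
proof
  interpret X: categorified_gset G X by fact
  assume "isomorphic_objs Y (p0 x) (p0 y)"
  then have "isomorphic_objs X (q0 (p0 x)) (q0 (p0 y))"
    by (rule isomorphic_objs_morphism[OF Y q])
  then show "isomorphic_objs X x y"
    using nat_iso_isomorphic_objs[OF qp xy(1)] nat_iso_isomorphic_objs[OF qp xy(2)]
    by (metis X.isomorphic_objs_sym X.isomorphic_objs_trans comp_apply)
qed (rule isomorphic_objs_morphism[OF X p])

text \<open>An equivalence reflects invertibility: naturality expresses \<open>a\<close> through
  \<open>q1 (p1 a)\<close> and invertible components, so if \<open>p1 a\<close> were invertible,
  \<open>a\<close> would be as well.\<close>

lemma equivalence_nonrigid: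
  assumes X: "categorified_gset G X" and Y: "categorified_gset G Y"
    and p: "catgset_morphism G X Y p0 p1" and q: "catgset_morphism G Y X q0 q1"
    and qp: "nat_iso G X X (q0 \<circ> p0) (q1 \<circ> p1) id id"
    and x: "x \<in> nonrigid X"
  shows "p0 x \<in> nonrigid Y"
proof -
  interpret X: categorified_gset G X by fact
  obtain a where a: "a \<in> points (Arr X)" "\<not> invertible_arrow X a" "x = src X a"
    using x by (auto simp: nonrigid_def)
  obtain t where t: "\<And>x. x \<in> points (Obj X) \<Longrightarrow>
      invertible_arrow X (t x) \<and> src X (t x) = q0 (p0 x) \<and> tgt X (t x) = x"
    and nat: "\<And>a. a \<in> points (Arr X) \<Longrightarrow>
      cmp X (t (tgt X a)) (q1 (p1 a)) = cmp X a (t (src X a))"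
    using nat_iso_component[OF qp] by (metis comp_apply)
  have "\<not> invertible_arrow Y (p1 a)"
  proof
    assume "invertible_arrow Y (p1 a)"
    then have "invertible_arrow X (q1 (p1 a))"
      by (rule invertible_arrow_morphism[OF Y q])
    then have 1: "invertible_arrow X (cmp X a (t (src X a)))"
      unfolding nat[OF a(1), symmetric] using t[of "tgt X a"] a
      by (intro X.invertible_arrow_cmp)
        (simp_all add: catgset_morphismD[OF p] catgset_morphismD[OF q])
    \<comment> \<open>Composing on the right with the inverse of the component at the source
      isolates \<open>a\<close>.\<close>
    obtain s where s: "inverse_arrows X (t (src X a)) s"
      using t[of "src X a"] a by (auto simp: invertible_arrow_def)
    have "invertible_arrow X (cmp X (cmp X a (t (src X a))) s)"
    proof (rule X.invertible_arrow_cmp[OF _ 1])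
      show "invertible_arrow X s"
        using inverse_arrows_sym[OF s] by (auto simp: invertible_arrow_def)
      show "src X (cmp X a (t (src X a))) = tgt X s"
        using s t[of "src X a"] a by (simp add: inverse_arrows_def)
    qed
    moreover have "cmp X (cmp X a (t (src X a))) s = a"
      using s t[of "src X a"] a by (simp add: inverse_arrows_def X.assoc)
    ultimately show False
      using a(2) by simp
  qed
  then show ?thesis
    using a catgset_morphismD(2,5)[OF p a(1)] by (force simp: nonrigid_def)
qed

lemma weakly_equivalent_pi0:
  assumes X: "categorified_gset G X" and Y: "categorified_gset G Y" and "weakly_equivalent G X Y"
  shows "gset_iso G (pi0 X) (pi0 Y)"
proof -
  interpret X: categorified_gset G X by fact
  interpret Y: categorified_gset G Y by fact
  obtain p0 p1 q0 q1 where p: "catgset_morphism G X Y p0 p1" and q: "catgset_morphism G Y X q0 q1"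
    and qp: "nat_iso G X X (q0 \<circ> p0) (q1 \<circ> p1) id id"
    and pq: "nat_iso G Y Y (p0 \<circ> q0) (p1 \<circ> q1) id id"
    using assms(3) unfolding weakly_equivalent_iff by blast
  note P = catgset_morphismD[OF p] and Q = catgset_morphismD[OF q]
  show ?thesis
  proof (rule X.pi0_gset_isoI[where h = "iso_class Y \<circ> p0"])
    show "equivariant G (Obj X) (pi0 Y) (iso_class Y \<circ> p0)"
      by (auto simp: equivariant_def P Y.act_pi0)
    \<comment> \<open>Essential surjectivity: \<open>q0 y\<close> is a preimage of \<open>y\<close>
      up to isomorphism.\<close>
    have "iso_class Y y = iso_class Y (p0 (q0 y))" if "y \<in> points (Obj Y)" for y
      using nat_iso_isomorphic_objs[OF pq that] that P Q
      by (simp add: Y.iso_class_eq_iff Y.isomorphic_objs_sym)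
    then show "(iso_class Y \<circ> p0) ` points (Obj X) = points (pi0 Y)"
      using P(1) Q(1) by (auto simp: pi0_def)
  next
    fix x y assume "x \<in> points (Obj X)" "y \<in> points (Obj X)"
    then show "(iso_class Y \<circ> p0) x = (iso_class Y \<circ> p0) y \<longleftrightarrow> isomorphic_objs X x y"
      using equivalence_isomorphic_objs_iff[OF X Y p q qp] by (simp add: Y.iso_class_eq_iff P)
  qed
qed

text \<open>Both images are \<open>A\<close> modulo the common kernel. This compares sets of classes
  that live in different types.\<close>

lemma card_image_eq_of_kernel_eq:
  assumes "\<And>x y. \<lbrakk>x \<in> A; y \<in> A\<rbrakk> \<Longrightarrow> f x = f y \<longleftrightarrow> h x = h y"
  shows "card (f ` A) = card (h ` A)"
proof -
  define k where "k z = f (SOME x. x \<in> A \<and> h x = z)" for z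
  have k: "k (h x) = f x" if "x \<in> A" for x
    using that someI[of "\<lambda>y. y \<in> A \<and> h y = h x" x] assms unfolding k_def by blast
  have "inj_on k (h ` A)"
    by (auto simp: inj_on_def k assms)
  moreover have "k ` h ` A = f ` A"
    by (simp add: image_image k)
  ultimately show ?thesis
    by (metis card_image)
qed

lemma weakly_equivalent_nonrigid_count:
  assumes X: "categorified_gset G X" and Y: "categorified_gset G Y" and "weakly_equivalent G X Y"
  shows "nonrigid_count X = nonrigid_count Y"
proof -
  interpret X: categorified_gset G X by fact
  interpret Y: categorified_gset G Y by fact
  obtain p0 p1 q0 q1 where p: "catgset_morphism G X Y p0 p1" and q: "catgset_morphism G Y X q0 q1"
    and qp: "nat_iso G X X (q0 \<circ> p0) (q1 \<circ> p1) id id"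
    and pq: "nat_iso G Y Y (p0 \<circ> q0) (p1 \<circ> q1) id id"
    using assms(3) unfolding weakly_equivalent_iff by blast
  note P = catgset_morphismD[OF p] and Q = catgset_morphismD[OF q]
  have "iso_class Y y = iso_class Y (p0 (q0 y))" if "y \<in> points (Obj Y)" for y
    using nat_iso_isomorphic_objs[OF pq that] that P Q
    by (simp add: Y.iso_class_eq_iff Y.isomorphic_objs_sym)
  \<comment> \<open>A nonrigid \<open>y\<close> has the class of \<open>p0 (q0 y)\<close>, and
    \<open>q0 y\<close> is nonrigid because the lemma also applies to the inverse
    equivalence.\<close>
  then have "iso_class Y ` nonrigid Y = (iso_class Y \<circ> p0) ` nonrigid X"
    using equivalence_nonrigid[OF X Y p q qp] equivalence_nonrigid[OF Y X q p pq] Y.nonrigid_subset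
    by (auto simp: image_iff subset_iff)
  moreover have "card ((iso_class Y \<circ> p0) ` nonrigid X) = card (iso_class X ` nonrigid X)"
    using X.nonrigid_subset equivalence_isomorphic_objs_iff[OF X Y p q qp]
    by (intro card_image_eq_of_kernel_eq)
      (auto simp: Y.iso_class_eq_iff X.iso_class_eq_iff P subset_iff)
  ultimately show ?thesis
    by (simp add: nonrigid_count_def)
qed

section \<open>Discrete categories and disjoint unions\<close>

lemma inverse_arrows_discrete:
  "inverse_arrows (discrete X) a b \<longleftrightarrow> a \<in> points X \<and> b = a"
  by (auto simp: inverse_arrows_def)

lemma invertible_arrow_discrete: "invertible_arrow (discrete X) a \<longleftrightarrow> a \<in> points X"
  by (simp add: invertible_arrow_def inverse_arrows_discrete)

text \<open>Every arrow of a discrete category is an identity, so the isomorphism classes are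
  singletons.\<close>

lemma pi0_discrete:
  assumes "right_gset G X"
  shows "gset_iso G (pi0 (discrete X)) X"
proof -
  interpret categorified_gset G "discrete X"
    by (rule categorified_gset_discrete[OF assms])
  show ?thesis
    by (rule pi0_gset_isoI[where h = id])
      (auto simp: equivariant_def isomorphic_objs_def invertible_arrow_discrete)
qed

text \<open>The endpoints force an inverse into the same summand, so the value
  \<open>undefined\<close> of composition across summands is never met.\<close>

lemma inverse_arrows_sum:
  "inverse_arrows (catgset_sum X Y) (Inl a) c \<longleftrightarrow> (\<exists>b. c = Inl b \<and> inverse_arrows X a b)"
  "inverse_arrows (catgset_sum X Y) (Inr a') c \<longleftrightarrow> (\<exists>b. c = Inr b \<and> inverse_arrows Y a' b)"
  by (cases c; auto simp: inverse_arrows_def)+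

lemma invertible_arrow_sum [simp]:
  "invertible_arrow (catgset_sum X Y) (Inl a) \<longleftrightarrow> invertible_arrow X a"
  "invertible_arrow (catgset_sum X Y) (Inr b) \<longleftrightarrow> invertible_arrow Y b"
  by (auto simp: invertible_arrow_def inverse_arrows_sum)

lemma isomorphic_objs_sum [simp]:
  "isomorphic_objs (catgset_sum X Y) (Inl x) (Inl x') \<longleftrightarrow> isomorphic_objs X x x'"
  "isomorphic_objs (catgset_sum X Y) (Inr y) (Inr y') \<longleftrightarrow> isomorphic_objs Y y y'"
  "\<not> isomorphic_objs (catgset_sum X Y) (Inl x) (Inr y)"
  "\<not> isomorphic_objs (catgset_sum X Y) (Inr y) (Inl x)"
  unfolding isomorphic_objs_def split_sum_ex by auto

text \<open>This makes \<open>map_sum (iso_class X) (iso_class Y)\<close> a model of the quotient of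
  the sum in which the summands remain visible; it serves both invariants.\<close>

lemma iso_class_sum_kernel:
  assumes "categorified_gset G X" "categorified_gset G Y"
    and "z \<in> points (Obj (catgset_sum X Y))" "z' \<in> points (Obj (catgset_sum X Y))"
  shows "map_sum (iso_class X) (iso_class Y) z = map_sum (iso_class X) (iso_class Y) z'
    \<longleftrightarrow> isomorphic_objs (catgset_sum X Y) z z'"
proof -
  interpret X: categorified_gset G X by fact
  interpret Y: categorified_gset G Y by fact
  show ?thesis
    using assms(3,4) by (cases z; cases z')
      (simp_all add: Plus_def image_iff X.iso_class_eq_iff Y.iso_class_eq_iff)
qed

lemma pi0_sum:
  assumes X: "categorified_gset G X" and Y: "categorified_gset G Y"
  shows "gset_iso G (pi0 (catgset_sum X Y)) (gset_sum (pi0 X) (pi0 Y))"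
proof -
  interpret X: categorified_gset G X by fact
  interpret Y: categorified_gset G Y by fact
  interpret categorified_gset G "catgset_sum X Y"
    by (rule categorified_gset_sum[OF X Y])
  show ?thesis
  proof (rule pi0_gset_isoI[where h = "map_sum (iso_class X) (iso_class Y)"])
    show "equivariant G (Obj (catgset_sum X Y)) (gset_sum (pi0 X) (pi0 Y))
        (map_sum (iso_class X) (iso_class Y))"
      by (auto simp: equivariant_def X.act_pi0 Y.act_pi0)
    show "map_sum (iso_class X) (iso_class Y) ` points (Obj (catgset_sum X Y))
        = points (gset_sum (pi0 X) (pi0 Y))"
      by (auto simp: Plus_def image_Un image_image)
  qed (rule iso_class_sum_kernel[OF X Y])
qed

lemma nonrigid_sum:
  "nonrigid (catgset_sum X Y) = Sum_Type.Plus (nonrigid X) (nonrigid Y)"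
  by (force simp: nonrigid_def image_iff)

lemma nonrigid_count_sum:
  assumes "fin_catgset G X" "fin_catgset G Y"
  shows "nonrigid_count (catgset_sum X Y) = nonrigid_count X + nonrigid_count Y"
proof -
  interpret X: categorified_gset G X using assms(1) by (simp add: fin_catgset_def)
  interpret Y: categorified_gset G Y using assms(2) by (simp add: fin_catgset_def)
  note cats = X.categorified_gset_axioms Y.categorified_gset_axioms
  interpret S: categorified_gset G "catgset_sum X Y"
    by (rule categorified_gset_sum[OF cats])
  have fin: "finite (nonrigid X)" "finite (nonrigid Y)"
    using assms X.finite_objects Y.finite_objects X.nonrigid_subset Y.nonrigid_subset
    by (auto simp: fin_catgset_def intro: finite_subset)
  \<comment> \<open>Classes in the sum are subsets of a sum type; the map with the same kernel
    replaces them by a disjoint union, whose cardinality splits.\<close>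
  have "nonrigid_count (catgset_sum X Y)
      = card (map_sum (iso_class X) (iso_class Y) ` nonrigid (catgset_sum X Y))"
    unfolding nonrigid_count_def
  proof (rule card_image_eq_of_kernel_eq)
    fix z z' assume "z \<in> nonrigid (catgset_sum X Y)" "z' \<in> nonrigid (catgset_sum X Y)"
    then have "z \<in> points (Obj (catgset_sum X Y))" "z' \<in> points (Obj (catgset_sum X Y))"
      using S.nonrigid_subset by blast+
    then show "iso_class (catgset_sum X Y) z = iso_class (catgset_sum X Y) z'
        \<longleftrightarrow> map_sum (iso_class X) (iso_class Y) z = map_sum (iso_class X) (iso_class Y) z'"
      using iso_class_sum_kernel[OF cats] S.iso_class_eq_iff by blast
  qed
  also have "map_sum (iso_class X) (iso_class Y) ` nonrigid (catgset_sum X Y)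
      = Sum_Type.Plus (iso_class X ` nonrigid X) (iso_class Y ` nonrigid Y)"
    unfolding nonrigid_sum by (auto simp: Plus_def image_Un image_image)
  finally show ?thesis
    using fin by (simp add: card_Plus nonrigid_count_def)
qed

lemma nonrigid_count_discrete: "nonrigid_count (discrete X) = 0"
  by (simp add: nonrigid_count_def nonrigid_def invertible_arrow_discrete)

text \<open>Booleans under conjunction form the smallest monoid that is not a group:
  \<open>True\<close> is the unit, and composing with the idempotent \<open>False\<close> never
  gives \<open>True\<close> back.\<close>

definition idempotent_catgset :: "(unit, bool, 'g) catgset" where
  "idempotent_catgset = \<lparr>Obj = gset_point, Arr = \<lparr>points = UNIV, act = \<lambda>a g. a\<rparr>,
     src = (\<lambda>a. ()), tgt = (\<lambda>a. ()), idn = (\<lambda>x. True), cmp = (\<and>)\<rparr>"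

lemma fin_catgset_idempotent:
  assumes "group G"
  shows "fin_catgset G idempotent_catgset"
proof -
  interpret group G by fact
  have "categorified_gset G idempotent_catgset"
    by unfold_locales
      (auto simp: idempotent_catgset_def equivariant_def composable_pairs_def gset_prod_def)
  then show ?thesis
    by (simp add: fin_catgset_def)
qed

lemma nonrigid_count_idempotent:
  "nonrigid_count (idempotent_catgset :: (unit, bool, 'g) catgset) = 1"
proof -
  let ?M = "idempotent_catgset :: (unit, bool, 'g) catgset"
  have "\<not> invertible_arrow ?M False"
    by (simp add: invertible_arrow_def inverse_arrows_def idempotent_catgset_def)
  then have "() \<in> nonrigid ?M"
    by (auto simp: nonrigid_def idempotent_catgset_def)
  then have "iso_class ?M ` nonrigid ?M = {iso_class ?M ()}"
    by auto
  then show ?thesis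
    by (simp add: nonrigid_count_def)
qed

section \<open>The discrete embedding\<close>

lemma fin_gset_pi0:
  assumes "fin_catgset G X"
  shows "fin_gset G (pi0 X)"
proof -
  interpret categorified_gset G X using assms by (simp add: fin_catgset_def)
  show ?thesis
    using assms finite_objects by (simp add: fin_gset_def right_gset_pi0 fin_catgset_def)
qed

lemma discrete_gset_iso:
  assumes "right_gset G X" "right_gset G Y" "gset_iso G X Y"
  shows "weakly_equivalent G (discrete X) (discrete Y)"
proof -
  obtain f where f: "equivariant G X Y f" "bij_betw f (points X) (points Y)"
    using assms(3) by (auto simp: gset_iso_def)
  show ?thesis
    by (rule weakly_equivalent_of_iso[where ?p0.0 = f and ?p1.0 = f])
      (use f assms in \<open>auto intro!: catgset_morphismI categorified_gset_discrete
        simp: equivariant_def\<close>)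
qed

lemma discrete_rig_map_class:
  assumes "fin_gset G X"
  shows "discrete_rig_map G (gset_class G X) = catgset_class G (discrete X)"
  unfolding discrete_rig_map_def
proof (rule UN_gset_class[OF assms])
  fix Z assume "fin_gset G Z" "gset_iso G X Z"
  then show "catgset_class G (discrete Z) = catgset_class G (discrete X)"
    using assms
    by (intro catgset_class_eqI categorified_gset_discrete weakly_equivalent_sym[OF discrete_gset_iso])
      (simp_all add: fin_gset_def)
qed

definition pi0_rig_map ::
  "('g, 'm) monoid_scheme \<Rightarrow> (nat, nat, 'g) catgset set \<Rightarrow> (nat, 'g) gset set" where
  "pi0_rig_map G A = (\<Union>X\<in>A. gset_class G (pi0 X))"

lemma pi0_rig_map_class:
  assumes "fin_catgset G X"
  shows "pi0_rig_map G (catgset_class G X) = gset_class G (pi0 X)"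
  unfolding pi0_rig_map_def
proof (rule UN_catgset_class[OF assms])
  fix Z assume Z: "fin_catgset G Z" "weakly_equivalent G X Z"
  then have "gset_iso G (pi0 X) (pi0 Z)"
    using assms by (simp add: weakly_equivalent_pi0 fin_catgset_def)
  then show "gset_class G (pi0 Z) = gset_class G (pi0 X)"
    using fin_gset_pi0[OF assms] gset_class_eqI[of G "pi0 X" "pi0 Z"] by (simp add: fin_gset_def)
qed

lemma pi0_rig_map_add:
  fixes G :: "('g, 'm) monoid_scheme"
  assumes "A \<in> carrier (cat_burnside_rig G)" "B \<in> carrier (cat_burnside_rig G)"
  shows "pi0_rig_map G (A \<oplus>\<^bsub>cat_burnside_rig G\<^esub> B)
    = pi0_rig_map G A \<oplus>\<^bsub>burnside_rig G\<^esub> pi0_rig_map G B"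
proof -
  obtain X :: "(nat, nat, 'g) catgset" where X: "fin_catgset G X" "A = catgset_class G X"
    using assms(1) by (rule cat_burnside_carrierE)
  obtain Y :: "(nat, nat, 'g) catgset" where Y: "fin_catgset G Y" "B = catgset_class G Y"
    using assms(2) by (rule cat_burnside_carrierE)
  have "gset_class G (pi0 (catgset_sum X Y)) = gset_class G (gset_sum (pi0 X) (pi0 Y))"
    using fin_gset_pi0[OF fin_catgset_sum[OF X(1) Y(1)]] X(1) Y(1)
    by (intro gset_class_eqI pi0_sum) (simp_all add: fin_gset_def fin_catgset_def)
  then show ?thesis
    using X Y by (simp add: cat_burnside_add burnside_add pi0_rig_map_class fin_catgset_sum fin_gset_pi0)
qed

lemma pi0_rig_map_discrete:
  fixes G :: "('g, 'm) monoid_scheme"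
  assumes "A \<in> carrier (burnside_rig G)"
  shows "pi0_rig_map G (discrete_rig_map G A) = A"
proof -
  obtain X :: "(nat, 'g) gset" where X: "fin_gset G X" "A = gset_class G X"
    using assms by (rule burnside_carrierE)
  have "gset_class G (pi0 (discrete X)) = gset_class G X"
    using fin_gset_pi0[OF fin_catgset_discrete[OF X(1)]] X(1)
    by (intro gset_class_eqI pi0_discrete) (simp_all add: fin_gset_def)
  then show ?thesis
    using X by (simp add: discrete_rig_map_class pi0_rig_map_class fin_catgset_discrete)
qed

text \<open>The two categories differ only in the value of \<open>cmp\<close> on arrows from
  different summands, which are never composable, so the identity maps form an isomorphism.\<close>

lemma discrete_sum:
  assumes "right_gset G X" "right_gset G Y"
  shows "weakly_equivalent G (discrete (gset_sum X Y)) (catgset_sum (discrete X) (discrete Y))"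
  by (rule weakly_equivalent_of_iso[OF _ _ catgset_morphismI, where ?p0.0 = id and ?p1.0 = id])
    (auto intro!: assms categorified_gset_discrete categorified_gset_sum right_gset_sum)

lemma discrete_prod:
  assumes "right_gset G X" "right_gset G Y"
  shows "weakly_equivalent G (discrete (gset_prod X Y)) (catgset_prod (discrete X) (discrete Y))"
  by (rule weakly_equivalent_of_iso[OF _ _ catgset_morphismI, where ?p0.0 = id and ?p1.0 = id])
    (auto intro!: assms categorified_gset_discrete categorified_gset_prod right_gset_prod)

theorem discrete_rig_hom:
  fixes G :: "('g, 'm) monoid_scheme"
  assumes "group G"
  shows "rig_hom (burnside_rig G) (cat_burnside_rig G) (discrete_rig_map G)"
proof (rule rig_pullback)
  show "rig (cat_burnside_rig G)"
    by (rule cat_burnside_rig_rig[OF assms])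
  \<comment> \<open>The retraction on classes supplies the injectivity through which
    \<open>burnside_rig G\<close> receives its semiring laws.\<close>
  show "inj_on (discrete_rig_map G) (carrier (burnside_rig G))"
    by (rule inj_on_inverseI) (rule pi0_rig_map_discrete)
  have fin: "fin_gset G gset_empty" "fin_gset G gset_point"
    using assms by (simp_all add: fin_gset_def right_gset_empty right_gset_point)
  note simps = burnside_add burnside_mult burnside_zero burnside_one
    cat_burnside_add cat_burnside_mult cat_burnside_zero cat_burnside_one
    discrete_rig_map_class fin_catgset_discrete fin_gset_sum fin_gset_prod fin
    gset_class_carrier catgset_class_carrier
  show "\<zero>\<^bsub>burnside_rig G\<^esub> \<in> carrier (burnside_rig G)" "\<one>\<^bsub>burnside_rig G\<^esub> \<in> carrier (burnside_rig G)"
    "discrete_rig_map G \<zero>\<^bsub>burnside_rig G\<^esub> = \<zero>\<^bsub>cat_burnside_rig G\<^esub>"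
    "discrete_rig_map G \<one>\<^bsub>burnside_rig G\<^esub> = \<one>\<^bsub>cat_burnside_rig G\<^esub>"
    by (simp_all add: simps)
  fix A assume "A \<in> carrier (burnside_rig G)"
  then obtain X :: "(nat, 'g) gset" where X: "fin_gset G X" "A = gset_class G X"
    by (rule burnside_carrierE)
  then show "discrete_rig_map G A \<in> carrier (cat_burnside_rig G)"
    by (simp add: simps)
  fix B assume "B \<in> carrier (burnside_rig G)"
  then obtain Y :: "(nat, 'g) gset" where Y: "fin_gset G Y" "B = gset_class G Y"
    by (rule burnside_carrierE)
  show "A \<oplus>\<^bsub>burnside_rig G\<^esub> B \<in> carrier (burnside_rig G)"
    "A \<otimes>\<^bsub>burnside_rig G\<^esub> B \<in> carrier (burnside_rig G)"
    using X Y by (simp_all add: simps)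
  note gsets = X(1)[unfolded fin_gset_def, THEN conjunct1] Y(1)[unfolded fin_gset_def, THEN conjunct1]
  have "catgset_class G (discrete (gset_sum X Y))
      = catgset_class G (catgset_sum (discrete X) (discrete Y))"
    using gsets by (intro catgset_class_eqI discrete_sum categorified_gset_discrete
        categorified_gset_sum right_gset_sum)
  then show "discrete_rig_map G (A \<oplus>\<^bsub>burnside_rig G\<^esub> B)
      = discrete_rig_map G A \<oplus>\<^bsub>cat_burnside_rig G\<^esub> discrete_rig_map G B"
    using X Y by (simp add: simps)
  have "catgset_class G (discrete (gset_prod X Y))
      = catgset_class G (catgset_prod (discrete X) (discrete Y))"
    using gsets by (intro catgset_class_eqI discrete_prod categorified_gset_discrete
        categorified_gset_prod right_gset_prod)
  then show "discrete_rig_map G (A \<otimes>\<^bsub>burnside_rig G\<^esub> B)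
      = discrete_rig_map G A \<otimes>\<^bsub>cat_burnside_rig G\<^esub> discrete_rig_map G B"
    using X Y by (simp add: simps)
qed

text \<open>A union over representatives, as in \<open>pi0_rig_map\<close>, works for values that
  are sets; for a number a member is chosen, and weak invariance makes the choice
  immaterial.\<close>

definition nonrigid_rig_count :: "(nat, nat, 'g) catgset set \<Rightarrow> nat" where
  "nonrigid_rig_count A = nonrigid_count (SOME X. X \<in> A)"

lemma nonrigid_rig_count_class:
  assumes "fin_catgset G X"
  shows "nonrigid_rig_count (catgset_class G X) = nonrigid_count X"
proof -
  obtain Z where "Z \<in> catgset_class G X"
    using assms by (rule catgset_class_rep)
  then have "(SOME Z. Z \<in> catgset_class G X) \<in> catgset_class G X"
    by (rule someI)
  then show ?thesis
    using assms weakly_equivalent_nonrigid_count[of G X "SOME Z. Z \<in> catgset_class G X"]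
    by (simp add: nonrigid_rig_count_def catgset_class_def finite_catgsets_def fin_catgset_def)
qed

theorem proposition6p3:
  fixes G :: "('g, 'm) monoid_scheme"
  assumes "group G"
  shows "ring_hom_cring (burnside_ring G) (cat_burnside_ring G) (discrete_burnside_map G)
    \<and> inj_on (discrete_burnside_map G) (carrier (burnside_ring G))
    \<and> \<not> (discrete_burnside_map G ` carrier (burnside_ring G) = carrier (cat_burnside_ring G))"
  unfolding burnside_ring_def cat_burnside_ring_def discrete_burnside_map_def
proof (intro conjI)
  interpret rig_hom "burnside_rig G" "cat_burnside_rig G" "discrete_rig_map G"
    by (rule discrete_rig_hom[OF assms])
  show "ring_hom_cring (groth_ring (burnside_rig G)) (groth_ring (cat_burnside_rig G))
      (groth_map (cat_burnside_rig G) (discrete_rig_map G))"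
    by (rule groth_map_ring_hom)
  show "inj_on (groth_map (cat_burnside_rig G) (discrete_rig_map G))
      (carrier (groth_ring (burnside_rig G)))"
  \<comment> \<open>The retraction left open by the rule is fixed to \<open>pi0_rig_map G\<close> by
    the statement shown first.\<close>
  proof (rule groth_map_inj)
    fix A assume "A \<in> carrier (cat_burnside_rig G)"
    then show "pi0_rig_map G A \<in> carrier (burnside_rig G)"
      by (elim cat_burnside_carrierE) (simp add: pi0_rig_map_class fin_gset_pi0 gset_class_carrier)
  qed (rule pi0_rig_map_add pi0_rig_map_discrete; assumption)+
  show "groth_map (cat_burnside_rig G) (discrete_rig_map G) ` carrier (groth_ring (burnside_rig G))
      \<noteq> carrier (groth_ring (cat_burnside_rig G))"
  \<comment> \<open>Here \<open>u\<close> becomes \<open>nonrigid_rig_count\<close> and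
    \<open>m\<close> the class of \<open>idempotent_catgset\<close>.\<close>
  proof (rule groth_map_not_surj)
    fix A B assume "A \<in> carrier (cat_burnside_rig G)" "B \<in> carrier (cat_burnside_rig G)"
    then show "nonrigid_rig_count (A \<oplus>\<^bsub>cat_burnside_rig G\<^esub> B)
        = nonrigid_rig_count A + nonrigid_rig_count B"
      by (elim cat_burnside_carrierE)
        (simp add: cat_burnside_add nonrigid_rig_count_class fin_catgset_sum nonrigid_count_sum)
  next
    fix A assume "A \<in> carrier (burnside_rig G)"
    then show "nonrigid_rig_count (discrete_rig_map G A) = 0"
      by (elim burnside_carrierE)
        (simp add: discrete_rig_map_class nonrigid_rig_count_class fin_catgset_discrete
          nonrigid_count_discrete)
  next
    show "catgset_class G idempotent_catgset \<in> carrier (cat_burnside_rig G)"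
      by (rule catgset_class_carrier[OF fin_catgset_idempotent[OF assms]])
    show "nonrigid_rig_count (catgset_class G idempotent_catgset) \<noteq> 0"
      by (simp add: nonrigid_rig_count_class[OF fin_catgset_idempotent[OF assms]]
          nonrigid_count_idempotent)
  qed
qed

end
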